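(* Let $\nabla$ and $\nabla^*$ be dual connections on a (pseudo-)Riemannian manifold $(M,g)$ and $\alpha\in\mathbb R$. Then the Ricci tensor and Ricci scalar of $\nabla^{(\alpha)}=\frac{1+\alpha}{2}\nabla+\frac{1-\alpha}{2}\nabla^*$ are, in any local coordinates, $$R^{(\alpha)}_{lj}=\frac{1+\alpha}{2}R_{lj}+\frac{1-\alpha}{2}R^*_{lj}+\frac{1-\alpha^2}{4}\mathcal K_{lj},\qquad R^{(\alpha)}=\frac{1+\alpha}{2}R+\frac{1-\alpha}{2}R^*+\frac{1-\alpha^2}{4}\mathcal K,$$ where $$\mathcal K_{lj}:=K^m_{\ il}K^i_{\ jm}-K^i_{\ im}K^m_{\ jl},\qquad \mathcal K:=g^{lj}\mathcal K_{lj}.$$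
   Context: Connections are affine connections, possibly with torsion. $\nabla$ and $\nabla^*$ are ($g$-)dual if $X(g(Y,Z))=g(\nabla_XY,Z)+g(Y,\nabla^*_XZ)$ for all vector fields. The difference tensor is $K(X,Y)=\nabla^*_XY-\nabla_XY$, with components in this statement given by $K(\partial_i,\partial_l)=K^m_{\ il}\partial_m$ (first lower index = direction of differentiation). Curvature: $R(X,Y)Z=\nabla_X\nabla_YZ-\nabla_Y\nabla_XZ-\nabla_{[X,Y]}Z$, components $R(\partial_k,\partial_l)\partial_i=R_{i\ kl}^{\ j}\partial_j$; Ricci tensor $R_{lj}=R_{l\ ij}^{\ i}$ (sum over $i$); Ricci scalar $R=g^{lj}R_{lj}$. $R_{lj},R$; $R^*_{lj},R^*$; $R^{(\alpha)}_{lj},R^{(\alpha)}$ refer to $\nabla$, $\nabla^*$, $\nabla^{(\alpha)}$ respectively. Summation over repeated indices is understood. *)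

theory Defs
  imports "HOL-Analysis.Analysis"
begin

text \<open>Only meant for open \<open>S\<close>: all partial derivatives of order at most \<open>k\<close> exist, are
  continuous on \<open>S\<close>, and those of order less than \<open>k\<close> are differentiable.\<close>

primrec Ck_on :: "nat \<Rightarrow> 'a::euclidean_space set \<Rightarrow> ('a \<Rightarrow> 'b::euclidean_space) \<Rightarrow> bool" where
  "Ck_on 0 S f \<longleftrightarrow> continuous_on S f"
| "Ck_on (Suc k) S f \<longleftrightarrow>
     (\<forall>x\<in>S. f differentiable (at x)) \<and> (\<forall>v. Ck_on k S (\<lambda>x. frechet_derivative f (at x) v))"

definition smooth_on :: "'a::euclidean_space set \<Rightarrow> ('a \<Rightarrow> 'b::euclidean_space) \<Rightarrow> bool" where
  "smooth_on S f \<longleftrightarrow> (\<forall>k. Ck_on k S f)"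

text \<open>A chart is a pair of its domain and a coordinate map, whose values outside the domain
  are irrelevant. The dimension of the manifold is \<open>CARD('n)\<close>.\<close>

type_synonym ('m, 'n) chart = "'m set \<times> ('m \<Rightarrow> real ^ 'n)"

abbreviation chart_dom :: "('m, 'n::finite) chart \<Rightarrow> 'm set" where
  "chart_dom c \<equiv> fst c"

abbreviation chart_map :: "('m, 'n::finite) chart \<Rightarrow> 'm \<Rightarrow> real ^ 'n" where
  "chart_map c \<equiv> snd c"

definition chart_inv :: "('m, 'n::finite) chart \<Rightarrow> real ^ 'n \<Rightarrow> 'm" where
  "chart_inv c = inv_into (chart_dom c) (chart_map c)"

definition is_chart :: "('m::topological_space, 'n::finite) chart \<Rightarrow> bool" where
  "is_chart c \<longleftrightarrow> open (chart_dom c) \<and> open (chart_map c ` chart_dom c) \<and>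
     homeomorphism (chart_dom c) (chart_map c ` chart_dom c) (chart_map c) (chart_inv c)"

definition compatible :: "('m::topological_space, 'n::finite) chart \<Rightarrow> ('m, 'n) chart \<Rightarrow> bool" where
  "compatible c d \<longleftrightarrow>
     smooth_on (chart_map c ` (chart_dom c \<inter> chart_dom d)) (chart_map d \<circ> chart_inv c) \<and>
     smooth_on (chart_map d ` (chart_dom c \<inter> chart_dom d)) (chart_map c \<circ> chart_inv d)"

text \<open>The manifold is the whole type \<open>'m\<close>, Hausdorff and second countable by its sort, and
  \<open>A\<close> is its maximal smooth atlas; hence its elements are all the local coordinate systems.\<close>

definition smooth_manifold ::
    "('m::{t2_space, second_countable_topology}, 'n::finite) chart set \<Rightarrow> bool" where
  "smooth_manifold A \<longleftrightarrow>
     (\<forall>c\<in>A. is_chart c) \<and>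
     (\<Union>c\<in>A. chart_dom c) = UNIV \<and>
     (\<forall>c\<in>A. \<forall>d\<in>A. compatible c d) \<and>
     (\<forall>d. is_chart d \<and> (\<forall>c\<in>A. compatible c d) \<longrightarrow> d \<in> A)"

definition smooth_fun :: "('m, 'n::finite) chart set \<Rightarrow> ('m \<Rightarrow> real) \<Rightarrow> bool" where
  "smooth_fun A f \<longleftrightarrow> (\<forall>c\<in>A. smooth_on (chart_map c ` chart_dom c) (f \<circ> chart_inv c))"

text \<open>Tangent vectors are directional derivatives, acting on global smooth functions. They are
  set to \<open>0\<close> on all other functions, so that equal tangent vectors are equal terms.\<close>

type_synonym 'm tvec = "('m \<Rightarrow> real) \<Rightarrow> real"

definition coord_vec :: "('m, 'n::finite) chart set \<Rightarrow> ('m, 'n) chart \<Rightarrow> 'n \<Rightarrow> 'm \<Rightarrow> 'm tvec" where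
  "coord_vec A c i p = (\<lambda>f. if smooth_fun A f
     then frechet_derivative (f \<circ> chart_inv c) (at (chart_map c p)) (axis i 1) else 0)"

definition coord_comb ::
    "('m, 'n::finite) chart set \<Rightarrow> ('m, 'n) chart \<Rightarrow> 'm \<Rightarrow> real ^ 'n \<Rightarrow> 'm tvec" where
  "coord_comb A c p a = (\<lambda>f. \<Sum>i\<in>UNIV. a $ i * coord_vec A c i p f)"

definition tangent_space :: "('m, 'n::finite) chart set \<Rightarrow> 'm \<Rightarrow> 'm tvec set" where
  "tangent_space A p = {v. \<exists>c\<in>A. p \<in> chart_dom c \<and> (\<exists>a. v = coord_comb A c p a)}"

text \<open>The \<open>a\<close> is unique because bump functions extend the coordinates to global smooth functions.\<close>

definition coords :: "('m, 'n::finite) chart set \<Rightarrow> ('m, 'n) chart \<Rightarrow> 'm \<Rightarrow> 'm tvec \<Rightarrow> real ^ 'n" where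
  "coords A c p v = (THE a. v = coord_comb A c p a)"

type_synonym 'm vfield = "'m \<Rightarrow> 'm tvec"

definition vf_apply :: "'m vfield \<Rightarrow> ('m \<Rightarrow> real) \<Rightarrow> 'm \<Rightarrow> real" where
  "vf_apply X f = (\<lambda>p. X p f)"

definition vector_field :: "('m, 'n::finite) chart set \<Rightarrow> 'm vfield \<Rightarrow> bool" where
  "vector_field A X \<longleftrightarrow> (\<forall>p. X p \<in> tangent_space A p) \<and>
     (\<forall>f. smooth_fun A f \<longrightarrow> smooth_fun A (vf_apply X f))"

definition vf_add :: "'m vfield \<Rightarrow> 'm vfield \<Rightarrow> 'm vfield" where
  "vf_add X Y = (\<lambda>p f. X p f + Y p f)"

definition vf_diff :: "'m vfield \<Rightarrow> 'm vfield \<Rightarrow> 'm vfield" where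
  "vf_diff X Y = (\<lambda>p f. X p f - Y p f)"

definition vf_scale :: "('m \<Rightarrow> real) \<Rightarrow> 'm vfield \<Rightarrow> 'm vfield" where
  "vf_scale h X = (\<lambda>p f. h p * X p f)"

definition lie_bracket :: "'m vfield \<Rightarrow> 'm vfield \<Rightarrow> 'm vfield" where
  "lie_bracket X Y = (\<lambda>p f. X p (vf_apply Y f) - Y p (vf_apply X f))"

type_synonym 'm bilin_field = "'m \<Rightarrow> 'm tvec \<Rightarrow> 'm tvec \<Rightarrow> real"

definition metric_fun :: "'m bilin_field \<Rightarrow> 'm vfield \<Rightarrow> 'm vfield \<Rightarrow> 'm \<Rightarrow> real" where
  "metric_fun g X Y = (\<lambda>p. g p (X p) (Y p))"

text \<open>The signature is arbitrary; the Riemannian case is included.\<close>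

definition pseudo_riemannian_metric :: "('m, 'n::finite) chart set \<Rightarrow> 'm bilin_field \<Rightarrow> bool" where
  "pseudo_riemannian_metric A g \<longleftrightarrow>
     (\<forall>p. \<forall>u\<in>tangent_space A p. \<forall>v\<in>tangent_space A p. g p u v = g p v u) \<and>
     (\<forall>p. \<forall>u\<in>tangent_space A p. \<forall>v\<in>tangent_space A p. \<forall>w\<in>tangent_space A p. \<forall>a b.
        g p (\<lambda>f. a * u f + b * v f) w = a * g p u w + b * g p v w) \<and>
     (\<forall>p. \<forall>u\<in>tangent_space A p. (\<forall>v\<in>tangent_space A p. g p u v = 0) \<longrightarrow> u = (\<lambda>f. 0)) \<and>
     (\<forall>X Y. vector_field A X \<and> vector_field A Y \<longrightarrow> smooth_fun A (metric_fun g X Y))"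

text \<open>\<open>D X Y\<close> is the covariant derivative of \<open>Y\<close> along \<open>X\<close>; torsion is allowed.\<close>

type_synonym 'm vf_op = "'m vfield \<Rightarrow> 'm vfield \<Rightarrow> 'm vfield"

definition affine_connection :: "('m, 'n::finite) chart set \<Rightarrow> 'm vf_op \<Rightarrow> bool" where
  "affine_connection A D \<longleftrightarrow>
     (\<forall>X Y. vector_field A X \<and> vector_field A Y \<longrightarrow> vector_field A (D X Y)) \<and>
     (\<forall>X X' Y. vector_field A X \<and> vector_field A X' \<and> vector_field A Y \<longrightarrow>
        D (vf_add X X') Y = vf_add (D X Y) (D X' Y)) \<and>
     (\<forall>h X Y. smooth_fun A h \<and> vector_field A X \<and> vector_field A Y \<longrightarrow>
        D (vf_scale h X) Y = vf_scale h (D X Y)) \<and>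
     (\<forall>X Y Y'. vector_field A X \<and> vector_field A Y \<and> vector_field A Y' \<longrightarrow>
        D X (vf_add Y Y') = vf_add (D X Y) (D X Y')) \<and>
     (\<forall>h X Y. smooth_fun A h \<and> vector_field A X \<and> vector_field A Y \<longrightarrow>
        D X (vf_scale h Y) = vf_add (vf_scale (vf_apply X h) Y) (vf_scale h (D X Y)))"

definition dual_connections ::
    "('m, 'n::finite) chart set \<Rightarrow> 'm bilin_field \<Rightarrow> 'm vf_op \<Rightarrow> 'm vf_op \<Rightarrow> bool" where
  "dual_connections A g D D' \<longleftrightarrow>
     affine_connection A D \<and> affine_connection A D' \<and>
     (\<forall>X Y Z p. vector_field A X \<and> vector_field A Y \<and> vector_field A Z \<longrightarrow>
        vf_apply X (metric_fun g Y Z) p = metric_fun g (D X Y) Z p + metric_fun g Y (D' X Z) p)"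

definition alpha_connection :: "real \<Rightarrow> 'm vf_op \<Rightarrow> 'm vf_op \<Rightarrow> 'm vf_op" where
  "alpha_connection \<alpha> D D' X Y =
     vf_add (vf_scale (\<lambda>p. (1 + \<alpha>) / 2) (D X Y)) (vf_scale (\<lambda>p. (1 - \<alpha>) / 2) (D' X Y))"

definition difference_tensor :: "'m vf_op \<Rightarrow> 'm vf_op \<Rightarrow> 'm vf_op" where
  "difference_tensor D D' X Y = vf_diff (D' X Y) (D X Y)"

definition curvature :: "'m vf_op \<Rightarrow> 'm vfield \<Rightarrow> 'm vfield \<Rightarrow> 'm vfield \<Rightarrow> 'm vfield" where
  "curvature D X Y Z =
     vf_diff (vf_diff (D X (D Y Z)) (D Y (D X Z))) (D (lie_bracket X Y) Z)"

text \<open>Connections act on global vector fields, whereas the coordinate fields of a chart live on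
  its domain only. As usual, an operator is evaluated on coordinate fields at \<open>p\<close> by means of
  global fields agreeing with them near \<open>p\<close>; by locality of connections the result does not
  depend on the choice.\<close>

definition coord_frame :: "('m::topological_space, 'n::finite) chart set \<Rightarrow> ('m, 'n) chart \<Rightarrow>
    'm \<Rightarrow> 'n \<Rightarrow> 'm vfield" where
  "coord_frame A c p = (SOME E. \<forall>i. vector_field A (E i) \<and>
     (\<exists>V. open V \<and> p \<in> V \<and> V \<subseteq> chart_dom c \<and> (\<forall>q\<in>V. E i q = coord_vec A c i q)))"

text \<open>Index order: \<open>difference_comp A c D D' p m i l\<close> is $K^m_{\ il}$,
  \<open>curvature_comp A c D p j i k l\<close> is $R_{i\ kl}^{\ j}$.\<close>

definition difference_comp :: "('m::topological_space, 'n::finite) chart set \<Rightarrow> ('m, 'n) chart \<Rightarrow>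
    'm vf_op \<Rightarrow> 'm vf_op \<Rightarrow> 'm \<Rightarrow> 'n \<Rightarrow> 'n \<Rightarrow> 'n \<Rightarrow> real" where
  "difference_comp A c D D' p m i l =
     (let E = coord_frame A c p in coords A c p (difference_tensor D D' (E i) (E l) p) $ m)"

definition curvature_comp :: "('m::topological_space, 'n::finite) chart set \<Rightarrow> ('m, 'n) chart \<Rightarrow>
    'm vf_op \<Rightarrow> 'm \<Rightarrow> 'n \<Rightarrow> 'n \<Rightarrow> 'n \<Rightarrow> 'n \<Rightarrow> real" where
  "curvature_comp A c D p j i k l =
     (let E = coord_frame A c p in coords A c p (curvature D (E k) (E l) (E i) p) $ j)"

definition ricci :: "('m::topological_space, 'n::finite) chart set \<Rightarrow> ('m, 'n) chart \<Rightarrow>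
    'm vf_op \<Rightarrow> 'm \<Rightarrow> 'n \<Rightarrow> 'n \<Rightarrow> real" where
  "ricci A c D p l j = (\<Sum>i\<in>UNIV. curvature_comp A c D p i l i j)"

definition metric_matrix :: "('m, 'n::finite) chart set \<Rightarrow> ('m, 'n) chart \<Rightarrow>
    'm bilin_field \<Rightarrow> 'm \<Rightarrow> real ^ 'n ^ 'n" where
  "metric_matrix A c g p = (\<chi> l j. g p (coord_vec A c l p) (coord_vec A c j p))"

definition metric_trace :: "('m, 'n::finite) chart set \<Rightarrow> ('m, 'n) chart \<Rightarrow>
    'm bilin_field \<Rightarrow> 'm \<Rightarrow> ('n \<Rightarrow> 'n \<Rightarrow> real) \<Rightarrow> real" where
  "metric_trace A c g p T =
     (\<Sum>l\<in>UNIV. \<Sum>j\<in>UNIV. matrix_inv (metric_matrix A c g p) $ l $ j * T l j)"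

definition ricci_scalar :: "('m::topological_space, 'n::finite) chart set \<Rightarrow> ('m, 'n) chart \<Rightarrow>
    'm bilin_field \<Rightarrow> 'm vf_op \<Rightarrow> 'm \<Rightarrow> real" where
  "ricci_scalar A c g D p = metric_trace A c g p (ricci A c D p)"

definition cal_K :: "('m::topological_space, 'n::finite) chart set \<Rightarrow> ('m, 'n) chart \<Rightarrow>
    'm vf_op \<Rightarrow> 'm vf_op \<Rightarrow> 'm \<Rightarrow> 'n \<Rightarrow> 'n \<Rightarrow> real" where
  "cal_K A c D D' p l j =
     (let K = difference_comp A c D D' p
      in \<Sum>i\<in>UNIV. \<Sum>m\<in>UNIV. K m i l * K i j m - K i i m * K m j l)"

definition cal_K_scalar :: "('m::topological_space, 'n::finite) chart set \<Rightarrow> ('m, 'n) chart \<Rightarrow>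
    'm bilin_field \<Rightarrow> 'm vf_op \<Rightarrow> 'm vf_op \<Rightarrow> 'm \<Rightarrow> real" where
  "cal_K_scalar A c g D D' p = metric_trace A c g p (cal_K A c D D' p)"

end

theory Submission
  imports Defs
begin

text \<open>
  Write $T = \nabla^* - \nabla$ for the difference tensor, $a = (1+\alpha)/2$ and
  $b = (1-\alpha)/2$, so that $a + b = 1$ and $ab = (1-\alpha^2)/4$. Expanding
  $(a\nabla_X + b\nabla^*_X)(a\nabla_Y + b\nabla^*_Y)Z$ and trading the mixed terms by
  $\nabla_X\nabla^*_Y + \nabla^*_X\nabla_Y = \nabla_X\nabla_Y + \nabla^*_X\nabla^*_Y - T_X T_Y$
  gives $a\nabla_X\nabla_Y Z + b\nabla^*_X\nabla^*_Y Z - ab\, T_X T_Y Z$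
  (\<open>alpha_second_derivative\<close>). Antisymmetrizing in $X$ and $Y$,
  \[ R^{(\alpha)}(X,Y)Z = a R(X,Y)Z + b R^*(X,Y)Z + ab\,(T_Y T_X Z - T_X T_Y Z) , \]
  with no bracket term left over, because $\nabla^{(\alpha)}$ is affine in its two ingredients
  (\<open>curvature_alpha\<close>). Tracing this identity in coordinates yields the Ricci tensors, and
  contracting with the inverse metric, which is linear, yields the scalars.

  Passing to components is where the manifold enters. In $T_X T_Y Z$ the operator $T_X$
  is applied to the global field $T_Y Z$, of which the formula uses only the components at one
  point; so $T_X$ has to be shown to act pointwise
  (\<open>function_linear_pointwise\<close>): it is linear over smooth functions, because the Leibniz terms of
  the two connections cancel, and a field times a bump function is a combination of a global frame
  with global smooth coefficients. Bump functions (\<open>bump_exists\<close>, \<open>cutoff_exists\<close>) also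
  extend coordinates and coordinate fields to the whole manifold; hence components are well defined
  (\<open>coords_coord_comb\<close>) and the frame in the definition of the components exists
  (\<open>coord_frame\<close>). Finally, components can be distributed over the curvature identity only if
  all its terms are tangent vectors. For $\nabla_{[X,Y]}Z$ this requires that the Lie bracket of
  vector fields is again a vector field, which rests on the symmetry of second derivatives
  (\<open>second_derivative_symmetric\<close>, \<open>vector_field_lie_bracket\<close>).
\<close>

section \<open>Smooth functions between Euclidean spaces\<close>

lemma has_frechet_derivative:
  "f differentiable (at x) \<Longrightarrow> (f has_derivative frechet_derivative f (at x)) (at x)"
  by (simp add: frechet_derivative_works)

lemma Ck_on_cong:
  assumes "open S" "Ck_on k S f" "\<And>x. x \<in> S \<Longrightarrow> f x = g x"
  shows "Ck_on k S g"
  using assms(2,3)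
proof (induction k arbitrary: f g)
  case 0
  then show ?case by (metis Ck_on.simps(1) continuous_on_cong)
next
  case (Suc k)
  have D: "(g has_derivative frechet_derivative f (at x)) (at x)" if "x \<in> S" for x
    by (rule has_derivative_transform_within_open[OF has_frechet_derivative[of f] \<open>open S\<close> that])
       (use Suc.prems that in auto)
  have "frechet_derivative g (at x) = frechet_derivative f (at x)" if "x \<in> S" for x
    using frechet_derivative_at[OF D[OF that]] by simp
  then have "Ck_on k S (\<lambda>x. frechet_derivative g (at x) v)" for v
    using Suc.IH[of "\<lambda>x. frechet_derivative f (at x) v"] Suc.prems(1) by simp
  with D show ?case by (auto simp: differentiable_def)
qed

text \<open>Any family of derivatives may serve in place of \<open>frechet_derivative\<close>; on an open set it
  is the same family. Closure under linear maps, addition, products and composition follows by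
  induction on the order through this rule.\<close>

lemma Ck_on_SucI:
  assumes "open S" and D: "\<And>x. x \<in> S \<Longrightarrow> (f has_derivative f' x) (at x)"
    and "\<And>v. Ck_on k S (\<lambda>x. f' x v)"
  shows "Ck_on (Suc k) S f"
proof -
  have "Ck_on k S (\<lambda>x. frechet_derivative f (at x) v)" for v
    by (rule Ck_on_cong[OF assms(1) assms(3)[of v]]) (simp add: frechet_derivative_at[OF D, symmetric])
  then show ?thesis using D by (auto simp: differentiable_def)
qed

text \<open>Differentiability at order zero yields the continuity that the base case asks for.\<close>

lemma Ck_on_SucD: "Ck_on (Suc k) S f \<Longrightarrow> Ck_on k S f"
proof (induction k arbitrary: f)
  case 0
  then show ?case
    by (auto intro!: continuous_at_imp_continuous_on differentiable_imp_continuous_within)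
next
  case (Suc k)
  then show ?case by (metis Ck_on.simps(2))
qed

lemma Ck_on_mono: "Ck_on k S f \<Longrightarrow> T \<subseteq> S \<Longrightarrow> Ck_on k T f"
  by (induction k arbitrary: f) (auto intro: continuous_on_subset)

lemma Ck_on_local:
  assumes "\<And>x. x \<in> S \<Longrightarrow> \<exists>T. open T \<and> x \<in> T \<and> Ck_on k T f"
  shows "Ck_on k S f"
  using assms
proof (induction k arbitrary: f)
  case 0
  then show ?case
    by (metis Ck_on.simps(1) continuous_at_imp_continuous_on continuous_on_eq_continuous_at)
next
  case (Suc k)
  have "f differentiable (at x)" if "x \<in> S" for x
    using Suc.prems[OF that] by auto
  moreover have "Ck_on k S (\<lambda>x. frechet_derivative f (at x) v)" for v
    using Suc.prems by (intro Suc.IH) fastforce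
  ultimately show ?case by auto
qed

lemma Ck_on_const: "open S \<Longrightarrow> Ck_on k S (\<lambda>x. c)"
  by (induction k arbitrary: c) (auto intro!: Ck_on_SucI[where f' = "\<lambda>x v. 0"])

lemma Ck_on_bounded_linear:
  assumes "open S" "bounded_linear L" "Ck_on k S f"
  shows "Ck_on k S (\<lambda>x. L (f x))"
  using assms(3)
proof (induction k arbitrary: f)
  case 0
  then show ?case using assms(2) by (simp add: bounded_linear.continuous_on)
next
  case (Suc k)
  show ?case
  proof (rule Ck_on_SucI[OF assms(1)])
    show "((\<lambda>x. L (f x)) has_derivative (\<lambda>v. L (frechet_derivative f (at x) v))) (at x)"
      if "x \<in> S" for x
      using Suc.prems that bounded_linear.has_derivative[OF assms(2) has_frechet_derivative] by auto
  qed (use Suc in auto)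
qed

lemma Ck_on_add:
  assumes "open S" "Ck_on k S f" "Ck_on k S g"
  shows "Ck_on k S (\<lambda>x. f x + g x)"
  using assms(2,3)
proof (induction k arbitrary: f g)
  case 0
  then show ?case by (auto intro: continuous_on_add)
next
  case (Suc k)
  show ?case
  proof (rule Ck_on_SucI[OF assms(1)])
    show "((\<lambda>x. f x + g x) has_derivative
        (\<lambda>v. frechet_derivative f (at x) v + frechet_derivative g (at x) v)) (at x)"
      if "x \<in> S" for x
      using Suc.prems that by (intro has_derivative_add has_frechet_derivative) auto
  qed (use Suc in auto)
qed

lemma Ck_on_scaleR:
  assumes "open S" "Ck_on k S f" "Ck_on k S g"
  shows "Ck_on k S (\<lambda>x. f x *\<^sub>R g x)"
  using assms(2,3)
proof (induction k arbitrary: f g)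
  case 0
  then show ?case by (auto intro: continuous_on_scaleR)
next
  case (Suc k)
  show ?case
  proof (rule Ck_on_SucI[OF assms(1)])
    show "((\<lambda>x. f x *\<^sub>R g x) has_derivative
        (\<lambda>v. f x *\<^sub>R frechet_derivative g (at x) v + frechet_derivative f (at x) v *\<^sub>R g x)) (at x)"
      if "x \<in> S" for x
      using Suc.prems that by (intro has_derivative_scaleR has_frechet_derivative) auto
    show "Ck_on k S (\<lambda>x. f x *\<^sub>R frechet_derivative g (at x) v
        + frechet_derivative f (at x) v *\<^sub>R g x)" for v
      using Suc.prems by (intro Ck_on_add[OF assms(1)] Suc.IH) (auto intro: Ck_on_SucD)
  qed
qed

lemma Ck_on_sum:
  assumes "open S" "\<And>i. i \<in> I \<Longrightarrow> Ck_on k S (f i)"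
  shows "Ck_on k S (\<lambda>x. \<Sum>i\<in>I. f i x)"
  using assms(2)
  by (induction I rule: infinite_finite_induct)
     (auto intro!: Ck_on_const Ck_on_add simp: assms(1))

text \<open>By the chain rule the derivative of the composition in direction \<open>v\<close> is the derivative of
  \<open>f\<close> at \<open>g x\<close> in a direction that itself varies with \<open>x\<close>. Expanding that direction in the basis
  leaves products of scalar functions with derivatives of \<open>f\<close> in fixed directions, and to the
  latter the induction hypothesis applies.\<close>

lemma Ck_on_compose:
  fixes f :: "'b::euclidean_space \<Rightarrow> 'c::euclidean_space"
  assumes "open S" "open T" "\<And>x. x \<in> S \<Longrightarrow> g x \<in> T" "Ck_on k T f" "Ck_on k S g"
  shows "Ck_on k S (\<lambda>x. f (g x))"
  using assms(4,5)
proof (induction k arbitrary: f)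
  case 0
  then show ?case using assms(3) by (auto intro: continuous_on_compose2)
next
  case (Suc k)
  let ?d = "\<lambda>x v. frechet_derivative f (at (g x)) (frechet_derivative g (at x) v)"
  show ?case
  proof (rule Ck_on_SucI[OF assms(1)])
    show "((\<lambda>x. f (g x)) has_derivative ?d x) (at x)" if "x \<in> S" for x
      using Suc.prems assms(3) that
      by (intro has_derivative_compose[of g _ x UNIV f] has_frechet_derivative) auto
    fix v
    have "Ck_on k S (\<lambda>x. \<Sum>b\<in>Basis. (frechet_derivative g (at x) v \<bullet> b) *\<^sub>R
        frechet_derivative f (at (g x)) b)"
      using Suc.prems Ck_on_SucD[OF Suc.prems(2)]
      by (intro Ck_on_sum Ck_on_scaleR Suc.IH assms(1)
            Ck_on_bounded_linear[OF _ bounded_linear_inner_left]) auto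
    then show "Ck_on k S (\<lambda>x. ?d x v)"
    proof (rule Ck_on_cong[OF assms(1)])
      fix x assume "x \<in> S"
      then have "linear (frechet_derivative f (at (g x)))"
        using Suc.prems(1) assms(3) by (auto intro: linear_frechet_derivative)
      from linear_sum[OF this, of "\<lambda>b. (frechet_derivative g (at x) v \<bullet> b) *\<^sub>R b" Basis]
      show "(\<Sum>b\<in>Basis. (frechet_derivative g (at x) v \<bullet> b) *\<^sub>R
          frechet_derivative f (at (g x)) b) = ?d x v"
        by (simp add: euclidean_representation linear_scale[OF \<open>linear _\<close>])
    qed
  qed
qed

lemma smooth_on_cong:
  "open S \<Longrightarrow> smooth_on S f \<Longrightarrow> (\<And>x. x \<in> S \<Longrightarrow> f x = g x) \<Longrightarrow> smooth_on S g"
  unfolding smooth_on_def by (intro allI Ck_on_cong[of S _ f g]) auto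

lemma smooth_on_mono: "smooth_on S f \<Longrightarrow> T \<subseteq> S \<Longrightarrow> smooth_on T f"
  unfolding smooth_on_def by (simp add: Ck_on_mono[of _ S])

lemma smooth_on_local:
  "(\<And>x. x \<in> S \<Longrightarrow> \<exists>T. open T \<and> x \<in> T \<and> smooth_on T f) \<Longrightarrow> smooth_on S f"
  unfolding smooth_on_def by (rule allI, rule Ck_on_local) fast

lemma smooth_on_const: "open S \<Longrightarrow> smooth_on S (\<lambda>x. c)"
  unfolding smooth_on_def by (simp add: Ck_on_const)

lemma smooth_on_bounded_linear:
  "open S \<Longrightarrow> bounded_linear L \<Longrightarrow> smooth_on S f \<Longrightarrow> smooth_on S (\<lambda>x. L (f x))"
  unfolding smooth_on_def by (intro allI Ck_on_bounded_linear[of S L _ f]) auto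

lemma smooth_on_add:
  "open S \<Longrightarrow> smooth_on S f \<Longrightarrow> smooth_on S g \<Longrightarrow> smooth_on S (\<lambda>x. f x + g x)"
  unfolding smooth_on_def by (simp add: Ck_on_add)

lemma smooth_on_sum:
  "open S \<Longrightarrow> (\<And>i. i \<in> I \<Longrightarrow> smooth_on S (f i)) \<Longrightarrow> smooth_on S (\<lambda>x. \<Sum>i\<in>I. f i x)"
  unfolding smooth_on_def by (simp add: Ck_on_sum)

lemma smooth_on_scaleR:
  "open S \<Longrightarrow> smooth_on S f \<Longrightarrow> smooth_on S g \<Longrightarrow> smooth_on S (\<lambda>x. f x *\<^sub>R g x)"
  unfolding smooth_on_def by (simp add: Ck_on_scaleR)

lemma smooth_on_mult:
  fixes f g :: "'a::euclidean_space \<Rightarrow> real"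
  shows "open S \<Longrightarrow> smooth_on S f \<Longrightarrow> smooth_on S g \<Longrightarrow> smooth_on S (\<lambda>x. f x * g x)"
  using smooth_on_scaleR[of S f g] by simp

lemma smooth_on_compose:
  fixes f :: "'b::euclidean_space \<Rightarrow> 'c::euclidean_space"
  shows "open S \<Longrightarrow> open T \<Longrightarrow> g ` S \<subseteq> T \<Longrightarrow> smooth_on T f \<Longrightarrow> smooth_on S g \<Longrightarrow>
    smooth_on S (\<lambda>x. f (g x))"
  unfolding smooth_on_def by (rule allI, rule Ck_on_compose[of S T g]) auto

lemma smooth_on_id: "open S \<Longrightarrow> smooth_on S (\<lambda>x. x)"
  unfolding smooth_on_def
proof
  show "open S \<Longrightarrow> Ck_on k S (\<lambda>x. x)" for k
    by (cases k) (auto intro!: Ck_on_SucI[where f' = "\<lambda>x v. v"] Ck_on_const)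
qed

lemma smooth_on_differentiable: "smooth_on S f \<Longrightarrow> x \<in> S \<Longrightarrow> f differentiable (at x)"
  unfolding smooth_on_def by (drule spec[of _ "Suc 0"]) simp

lemma smooth_on_frechet_derivative:
  "smooth_on S f \<Longrightarrow> smooth_on S (\<lambda>x. frechet_derivative f (at x) v)"
  unfolding smooth_on_def
proof
  show "\<forall>k. Ck_on k S f \<Longrightarrow> Ck_on k S (\<lambda>x. frechet_derivative f (at x) v)" for k
    by (drule spec[of _ "Suc k"]) simp
qed

lemma smooth_on_continuous: "smooth_on S f \<Longrightarrow> continuous_on S f"
  unfolding smooth_on_def by (drule spec[of _ 0]) simp

section \<open>Symmetry of second derivatives\<close>

text \<open>The mean value theorem, applied first in direction \<open>a\<close> to the increment of \<open>F\<close> along \<open>b\<close> and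
  then in direction \<open>b\<close> to the derivative of \<open>F\<close> along \<open>a\<close>.\<close>

lemma second_difference:
  fixes F :: "'a::euclidean_space \<Rightarrow> real"
  assumes F: "smooth_on S F" and t: "0 < t"
    and S: "\<And>s u. 0 \<le> s \<Longrightarrow> s \<le> t \<Longrightarrow> 0 \<le> u \<Longrightarrow> u \<le> t \<Longrightarrow> x + s *\<^sub>R a + u *\<^sub>R b \<in> S"
  shows "\<exists>s u. 0 \<le> s \<and> s \<le> t \<and> 0 \<le> u \<and> u \<le> t \<and>
    F (x + t *\<^sub>R a + t *\<^sub>R b) - F (x + t *\<^sub>R a) - F (x + t *\<^sub>R b) + F x =
    t * t * frechet_derivative (\<lambda>y. frechet_derivative F (at y) a) (at (x + s *\<^sub>R a + u *\<^sub>R b)) b"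
proof -
  let ?F' = "\<lambda>y. frechet_derivative F (at y)"
  let ?F'' = "\<lambda>y. frechet_derivative (\<lambda>y. ?F' y a) (at y)"
  have path: "((\<lambda>s. H (z + s *\<^sub>R w)) has_real_derivative frechet_derivative H (at (z + s *\<^sub>R w)) w) (at s)"
    if "H differentiable (at (z + s *\<^sub>R w))" for H :: "'a \<Rightarrow> real" and z w s
  proof -
    have "((\<lambda>s. H (z + s *\<^sub>R w)) has_derivative
        (\<lambda>h. frechet_derivative H (at (z + s *\<^sub>R w)) (h *\<^sub>R w))) (at s)"
      by (rule has_derivative_compose[of "\<lambda>s. z + s *\<^sub>R w" _ s UNIV H])
         (auto intro!: derivative_eq_intros has_frechet_derivative that)
    then show ?thesis
      using linear_frechet_derivative[OF that]
      by (simp add: has_field_derivative_def linear_scale mult.commute[of _ "frechet_derivative _ _ _"])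
  qed
  have S1: "x + s *\<^sub>R a + t *\<^sub>R b \<in> S" "x + s *\<^sub>R a \<in> S" if "0 \<le> s" "s \<le> t" for s
    using S[OF that, of t] S[OF that, of 0] t by auto
  have "((\<lambda>s. F (x + s *\<^sub>R a + t *\<^sub>R b) - F (x + s *\<^sub>R a)) has_real_derivative
      ?F' (x + s *\<^sub>R a + t *\<^sub>R b) a - ?F' (x + s *\<^sub>R a) a) (at s)" if "0 \<le> s" "s \<le> t" for s
    using path[of F "x + t *\<^sub>R b" s a] path[of F x s a] S1[OF that]
      smooth_on_differentiable[OF F]
    by (intro DERIV_diff) (simp_all add: algebra_simps)
  then obtain s where s: "0 < s" "s < t" and
    s_eq: "F (x + t *\<^sub>R a + t *\<^sub>R b) - F (x + t *\<^sub>R a) - (F (x + 0 *\<^sub>R a + t *\<^sub>R b) - F (x + 0 *\<^sub>R a)) =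
      (t - 0) * (?F' (x + s *\<^sub>R a + t *\<^sub>R b) a - ?F' (x + s *\<^sub>R a) a)"
    using MVT2[OF t, of "\<lambda>s. F (x + s *\<^sub>R a + t *\<^sub>R b) - F (x + s *\<^sub>R a)"
        "\<lambda>s. ?F' (x + s *\<^sub>R a + t *\<^sub>R b) a - ?F' (x + s *\<^sub>R a) a"]
    by blast
  have "((\<lambda>u. ?F' (x + s *\<^sub>R a + u *\<^sub>R b) a) has_real_derivative
      ?F'' (x + s *\<^sub>R a + u *\<^sub>R b) b) (at u)" if "0 \<le> u" "u \<le> t" for u
    using s S[of s u] that
    by (intro path smooth_on_differentiable[OF smooth_on_frechet_derivative[OF F]]) auto
  then obtain u where u: "0 < u" "u < t" and
    u_eq: "?F' (x + s *\<^sub>R a + t *\<^sub>R b) a - ?F' (x + s *\<^sub>R a + 0 *\<^sub>R b) a =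
      (t - 0) * ?F'' (x + s *\<^sub>R a + u *\<^sub>R b) b"
    using MVT2[OF t, of "\<lambda>u. ?F' (x + s *\<^sub>R a + u *\<^sub>R b) a" "\<lambda>u. ?F'' (x + s *\<^sub>R a + u *\<^sub>R b) b"]
    by blast
  show ?thesis
    using s u s_eq u_eq by (intro exI[of _ s] exI[of _ u]) (simp add: algebra_simps)
qed

text \<open>The second difference over a small parallelogram does not depend on the order of its two sides,
  and divided by \<open>t\<^sup>2\<close> it is a value, near \<open>x\<close>, of either one of the two mixed derivatives. As
  these are continuous, they agree at \<open>x\<close>.\<close>

lemma second_derivative_symmetric:
  fixes F :: "'a::euclidean_space \<Rightarrow> real"
  assumes "open S" and F: "smooth_on S F" and "x \<in> S"
  shows "frechet_derivative (\<lambda>y. frechet_derivative F (at y) a) (at x) b =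
    frechet_derivative (\<lambda>y. frechet_derivative F (at y) b) (at x) a"
proof (rule ccontr)
  let ?H = "\<lambda>a b y. frechet_derivative (\<lambda>y. frechet_derivative F (at y) a) (at y) b"
  assume ne: "?H a b x \<noteq> ?H b a x"
  define e where "e = \<bar>?H a b x - ?H b a x\<bar> / 2"
  have "e > 0" using ne by (simp add: e_def)
  have "isCont (?H a b) x" "isCont (?H b a) x"
    using smooth_on_continuous[OF smooth_on_frechet_derivative[OF smooth_on_frechet_derivative[OF F]]]
      assms(1,3) by (auto simp: continuous_on_eq_continuous_at)
  then obtain d1 d2 where d: "d1 > 0" "d2 > 0"
      "\<And>y. dist y x < d1 \<Longrightarrow> dist (?H a b y) (?H a b x) < e"
      "\<And>y. dist y x < d2 \<Longrightarrow> dist (?H b a y) (?H b a x) < e"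
    using \<open>e > 0\<close> unfolding continuous_at_eps_delta by (metis dist_commute)
  obtain d3 where d3: "d3 > 0" "ball x d3 \<subseteq> S"
    using assms(1,3) openE by blast
  define r where "r = min d3 (min d1 d2)"
  \<comment> \<open>With this \<open>t\<close> the parallelogram with sides \<open>t a\<close> and \<open>t b\<close> at \<open>x\<close> stays within distance \<open>r\<close>;
    the summand 1 keeps \<open>M\<close> positive when \<open>a\<close> and \<open>b\<close> vanish.\<close>
  define M where "M = norm a + norm b + 1"
  define t where "t = r / (2 * M)"
  have "r > 0" using d d3 by (simp add: r_def)
  have "M > 0" by (simp add: M_def add_nonneg_pos)
  then have "t > 0" using \<open>r > 0\<close> by (simp add: t_def)
  have near: "dist (x + s *\<^sub>R a + u *\<^sub>R b) x < r" "dist (x + s *\<^sub>R b + u *\<^sub>R a) x < r"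
    if "0 \<le> s" "s \<le> t" "0 \<le> u" "u \<le> t" for s u
  proof -
    have "norm (s *\<^sub>R a + u *\<^sub>R b) \<le> s * norm a + u * norm b"
         "norm (s *\<^sub>R b + u *\<^sub>R a) \<le> s * norm b + u * norm a"
      using that by (metis abs_of_nonneg norm_scaleR norm_triangle_ineq)+
    moreover have "s * norm a \<le> t * norm a" "u * norm b \<le> t * norm b"
         "s * norm b \<le> t * norm b" "u * norm a \<le> t * norm a"
      using that by (auto intro: mult_right_mono)
    moreover have "t * M = r / 2" using \<open>M > 0\<close> by (simp add: t_def)
    then have "t * norm a + t * norm b + t = r / 2" by (simp add: M_def distrib_left)
    moreover have "dist (x + s *\<^sub>R a + u *\<^sub>R b) x = norm (s *\<^sub>R a + u *\<^sub>R b)"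
        "dist (x + s *\<^sub>R b + u *\<^sub>R a) x = norm (s *\<^sub>R b + u *\<^sub>R a)"
      by (simp_all add: dist_norm add.assoc)
    ultimately show "dist (x + s *\<^sub>R a + u *\<^sub>R b) x < r" "dist (x + s *\<^sub>R b + u *\<^sub>R a) x < r"
      using \<open>t > 0\<close> \<open>r > 0\<close> by linarith+
  qed
  then have S: "x + s *\<^sub>R a + u *\<^sub>R b \<in> S" "x + s *\<^sub>R b + u *\<^sub>R a \<in> S"
    if "0 \<le> s" "s \<le> t" "0 \<le> u" "u \<le> t" for s u
    using that d3(2) by (auto simp: r_def dist_commute subset_iff)
  obtain s u where su: "0 \<le> s" "s \<le> t" "0 \<le> u" "u \<le> t"
    "F (x + t *\<^sub>R a + t *\<^sub>R b) - F (x + t *\<^sub>R a) - F (x + t *\<^sub>R b) + F x = t * t * ?H a b (x + s *\<^sub>R a + u *\<^sub>R b)"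
    using second_difference[OF F \<open>t > 0\<close>, of x a b] S(1) by blast
  obtain s' u' where su': "0 \<le> s'" "s' \<le> t" "0 \<le> u'" "u' \<le> t"
    "F (x + t *\<^sub>R b + t *\<^sub>R a) - F (x + t *\<^sub>R b) - F (x + t *\<^sub>R a) + F x = t * t * ?H b a (x + s' *\<^sub>R b + u' *\<^sub>R a)"
    using second_difference[OF F \<open>t > 0\<close>, of x b a] S(2) by blast
  have "t * t * ?H a b (x + s *\<^sub>R a + u *\<^sub>R b) = t * t * ?H b a (x + s' *\<^sub>R b + u' *\<^sub>R a)"
    using su(5) su'(5) by (simp add: algebra_simps)
  then have "?H a b (x + s *\<^sub>R a + u *\<^sub>R b) = ?H b a (x + s' *\<^sub>R b + u' *\<^sub>R a)"
    using \<open>t > 0\<close> by simp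
  moreover have "dist (?H a b (x + s *\<^sub>R a + u *\<^sub>R b)) (?H a b x) < e"
    using near(1)[OF su(1-4)] d(3) by (auto simp: r_def)
  moreover have "dist (?H b a (x + s' *\<^sub>R b + u' *\<^sub>R a)) (?H b a x) < e"
    using near(2)[OF su'(1-4)] d(4) by (auto simp: r_def)
  ultimately show False
    unfolding e_def dist_real_def by argo
qed

section \<open>Bump functions\<close>

text \<open>\<open>flat 0\<close> is the classical smooth function all of whose derivatives vanish at 0. The powers of
  \<open>1 / t\<close> are there because the derivative of each member is a linear combination of two others.\<close>

definition flat :: "nat \<Rightarrow> real \<Rightarrow> real" where
  "flat k t = (if t \<le> 0 then 0 else exp (- inverse t) * inverse t ^ k)"

text \<open>The exponential beats every power of \<open>1 / t\<close>. Since the difference quotient of \<open>flat k\<close> at 0 is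
  \<open>flat (k + 1)\<close>, this limit is also what makes \<open>flat k\<close> differentiable there.\<close>

lemma flat_tendsto_0: "(flat k \<longlongrightarrow> 0) (at 0)"
proof -
  have "((\<lambda>t. inverse t ^ k / exp (inverse t)) \<longlongrightarrow> (0::real)) (at_right 0)"
    by (rule filterlim_compose[OF tendsto_power_div_exp_0 filterlim_inverse_at_top_right])
  moreover have "eventually (\<lambda>t. inverse t ^ k / exp (inverse t) = flat k t) (at_right 0)"
    by (auto simp: eventually_at_filter flat_def exp_minus field_simps)
  ultimately have "(flat k \<longlongrightarrow> 0) (at_right 0)"
    using tendsto_cong by fastforce
  moreover have "(flat k \<longlongrightarrow> 0) (at_left 0)"
    by (rule tendsto_eventually) (auto simp: eventually_at_filter flat_def)
  ultimately show ?thesis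
    by (simp add: filterlim_split_at_real)
qed

lemma flat_has_derivative:
  "(flat k has_real_derivative flat (k + 2) t - k * flat (k + 1) t) (at t)"
proof (cases t "0::real" rule: linorder_cases)
  case less
  have "((\<lambda>_. 0::real) has_real_derivative 0) (at t)" by simp
  then have "(flat k has_real_derivative 0) (at t)"
    by (rule has_field_derivative_transform_within_open[of _ _ _ "{..<0}"])
       (use less in \<open>auto simp: flat_def\<close>)
  then show ?thesis using less by (simp add: flat_def)
next
  case equal
  have "(\<lambda>h. (flat k (0 + h) - flat k 0) / h) = flat (k + 1)"
    by (auto simp: fun_eq_iff flat_def divide_simps)
  then have "(flat k has_real_derivative 0) (at 0)"
    using flat_tendsto_0[of "k + 1"] by (simp add: DERIV_def)
  then show ?thesis using equal by (simp add: flat_def)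
next
  case greater
  \<comment> \<open>The power rule leaves \<open>inverse t ^ (k - 1)\<close> behind, with truncated subtraction.\<close>
  have power: "k - 1 = 0 \<or> inverse t ^ (k - 1) = inverse t * inverse t ^ (k - 1 - 1)"
    by (cases "k - 1") auto
  have "((\<lambda>t. exp (- inverse t) * inverse t ^ k) has_real_derivative
      flat (k + 2) t - k * flat (k + 1) t) (at t)"
    using greater power
    by (cases k) (auto intro!: derivative_eq_intros simp: flat_def algebra_simps power2_eq_square)
  then show ?thesis
    by (rule has_field_derivative_transform_within_open[of _ _ _ "{0<..}"])
       (use greater in \<open>auto simp: flat_def\<close>)
qed

lemma smooth_on_flat: "smooth_on UNIV (flat k)"
  unfolding smooth_on_def
proof
  show "Ck_on n UNIV (flat k)" for n
  proof (induction n arbitrary: k)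
    case 0
    show ?case
      using flat_has_derivative
      by (auto intro!: continuous_at_imp_continuous_on intro: DERIV_isCont)
  next
    case (Suc n)
    show ?case
    proof (rule Ck_on_SucI[OF open_UNIV])
      show "(flat k has_derivative (\<lambda>v. v * (flat (k + 2) t + (- real k) * flat (k + 1) t))) (at t)" for t
        using flat_has_derivative[of k t]
        by (simp add: has_field_derivative_def mult.commute[of _ "_ - _"])
      show "Ck_on n UNIV (\<lambda>t. v * (flat (k + 2) t + (- real k) * flat (k + 1) t))" for v
        by (intro Ck_on_bounded_linear[OF open_UNIV bounded_linear_mult_right] Ck_on_add Suc) auto
    qed
  qed
qed

text \<open>Two flat functions in a row, \<open>flat 0 (exp (- 1) - flat 0 (n y))\<close>, form a smooth step without any
  division by a varying quantity: for \<open>n y \<le> 0\<close> the inner one vanishes and the value is a positive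
  constant, and for \<open>n y \<ge> 1\<close> the inner one is at least \<open>exp (- 1)\<close>, which makes the outer one
  vanish. The step is composed with \<open>n y = (dist x y)\<^sup>2 / r\<^sup>2 - 1\<close>.\<close>

lemma bump_exists:
  fixes x :: "'a::euclidean_space"
  assumes "r > 0"
  shows "\<exists>h::'a \<Rightarrow> real. smooth_on UNIV h \<and> (\<forall>y\<in>ball x r. h y = 1) \<and>
    (\<forall>y. 2 * r \<le> dist x y \<longrightarrow> h y = 0)"
proof -
  define n where "n = (\<lambda>y. ((y - x) \<bullet> (y - x)) / r\<^sup>2 - 1)"
  define m where "m = flat 0 (exp (- 1))"
  define h where "h = (\<lambda>y. flat 0 (exp (- 1) - flat 0 (n y)) / m)"
  have n_eq: "n y = (dist x y)\<^sup>2 / r\<^sup>2 - 1" for y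
    by (simp add: n_def dist_norm norm_minus_commute flip: power2_norm_eq_inner)
  have diff: "smooth_on UNIV (\<lambda>y. y - x)"
    using smooth_on_add[OF open_UNIV smooth_on_id smooth_on_const[of UNIV "- x"]] by simp
  have "smooth_on UNIV (\<lambda>y. \<Sum>b\<in>Basis. ((y - x) \<bullet> b) * ((y - x) \<bullet> b))"
    by (intro smooth_on_sum[OF open_UNIV] smooth_on_mult[OF open_UNIV]
        smooth_on_bounded_linear[OF open_UNIV bounded_linear_inner_left diff])
  then have "smooth_on UNIV (\<lambda>y. (y - x) \<bullet> (y - x))"
    by (rule smooth_on_cong[OF open_UNIV]) (rule euclidean_inner[symmetric])
  then have "smooth_on UNIV n"
    using smooth_on_add[OF open_UNIV smooth_on_bounded_linear[OF open_UNIV bounded_linear_divide]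
        smooth_on_const[OF open_UNIV, of "- 1"]] by (simp add: n_def)
  then have "smooth_on UNIV (\<lambda>y. - flat 0 (n y))"
    by (intro smooth_on_bounded_linear[OF open_UNIV bounded_linear_minus[OF bounded_linear_ident]]
        smooth_on_compose[OF open_UNIV open_UNIV _ smooth_on_flat]) auto
  then have "smooth_on UNIV (\<lambda>y. exp (- 1) + - flat 0 (n y))"
    by (rule smooth_on_add[OF open_UNIV smooth_on_const[OF open_UNIV]])
  then have "smooth_on UNIV h"
    unfolding h_def
    by (intro smooth_on_bounded_linear[OF open_UNIV bounded_linear_divide]
        smooth_on_compose[OF open_UNIV open_UNIV _ smooth_on_flat]) auto
  moreover have "h y = 1" if "y \<in> ball x r" for y
  proof -
    have "(dist x y)\<^sup>2 \<le> r\<^sup>2" using that by (simp add: power_mono)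
    then have "n y \<le> 0"
      using assms by (simp add: n_eq)
    then show ?thesis by (simp add: h_def m_def flat_def)
  qed
  moreover have "h y = 0" if "2 * r \<le> dist x y" for y
  proof -
    have "(2 * r)\<^sup>2 \<le> (dist x y)\<^sup>2" using that assms by (intro power_mono) auto
    moreover have "2 * r\<^sup>2 \<le> (2 * r)\<^sup>2" by (simp add: power_mult_distrib)
    ultimately have "2 * r\<^sup>2 \<le> (dist x y)\<^sup>2" by linarith
    then have "n y \<ge> 1"
      using assms by (simp add: n_eq le_divide_eq)
    then have "inverse (n y) \<le> 1" by (simp add: inverse_le_1_iff)
    then have "exp (- 1) \<le> flat 0 (n y)" using \<open>n y \<ge> 1\<close> by (simp add: flat_def)
    then show ?thesis by (simp add: h_def flat_def)
  qed
  ultimately show ?thesis by blast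
qed

section \<open>Smooth functions and tangent vectors\<close>

context
  fixes A :: "('m::{t2_space, second_countable_topology}, 'n::finite) chart set"
  assumes mfd: "smooth_manifold A"
begin

lemma chart_homeomorphism:
  assumes "c \<in> A"
  shows "homeomorphism (chart_dom c) (chart_map c ` chart_dom c) (chart_map c) (chart_inv c)"
  using mfd assms unfolding smooth_manifold_def is_chart_def by blast

lemma chart_open:
  assumes "c \<in> A"
  shows "open (chart_dom c)" "open (chart_map c ` chart_dom c)"
  using mfd assms unfolding smooth_manifold_def is_chart_def by blast+

lemma chart_inv_map [simp]: "c \<in> A \<Longrightarrow> q \<in> chart_dom c \<Longrightarrow> chart_inv c (chart_map c q) = q"
  using chart_homeomorphism by (metis homeomorphism_def)

lemma chart_open_image:
  assumes "c \<in> A" "open V" "V \<subseteq> chart_dom c"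
  shows "open (chart_map c ` V)"
proof -
  have "openin (top_of_set (chart_dom c)) V"
    using assms by (simp add: openin_open_eq chart_open)
  then have "openin (top_of_set (chart_map c ` chart_dom c)) (chart_map c ` V)"
    by (rule homeomorphism_imp_open_map[OF chart_homeomorphism[OF assms(1)]])
  then show ?thesis
    using openin_open_eq[OF chart_open(2)[OF assms(1)]] by blast
qed

lemma chart_exists: "\<exists>c\<in>A. p \<in> chart_dom c"
  using mfd unfolding smooth_manifold_def by blast

lemma transition_smooth:
  assumes "c \<in> A" "d \<in> A"
  shows "smooth_on (chart_map d ` (chart_dom c \<inter> chart_dom d)) (\<lambda>x. chart_map c (chart_inv d x))"
  using mfd assms unfolding smooth_manifold_def compatible_def comp_def by blast

lemma smooth_fun_in_chart:
  "smooth_fun A f \<Longrightarrow> c \<in> A \<Longrightarrow> smooth_on (chart_map c ` chart_dom c) (\<lambda>x. f (chart_inv c x))"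
  unfolding smooth_fun_def comp_def by blast

lemma smooth_fun_const: "smooth_fun A (\<lambda>p. r)"
  unfolding smooth_fun_def comp_def by (simp add: smooth_on_const chart_open)

lemma smooth_fun_add: "smooth_fun A f \<Longrightarrow> smooth_fun A g \<Longrightarrow> smooth_fun A (\<lambda>p. f p + g p)"
  unfolding smooth_fun_def comp_def by (simp add: smooth_on_add chart_open)

lemma smooth_fun_mult: "smooth_fun A f \<Longrightarrow> smooth_fun A g \<Longrightarrow> smooth_fun A (\<lambda>p. f p * g p)"
  unfolding smooth_fun_def comp_def by (simp add: smooth_on_mult chart_open)

lemma smooth_fun_diff: "smooth_fun A f \<Longrightarrow> smooth_fun A g \<Longrightarrow> smooth_fun A (\<lambda>p. f p - g p)"
  using smooth_fun_add[of f "\<lambda>p. - 1 * g p"] smooth_fun_mult[OF smooth_fun_const[of "- 1"], of g]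
  by simp

text \<open>Near a point of the domain of \<open>c\<close> the extension is \<open>h\<close> after a transition map. Near any other
  point it vanishes, because the image of \<open>K\<close> in the manifold is compact, hence closed.\<close>

lemma smooth_fun_extend_by_zero:
  assumes c: "c \<in> A" and h: "smooth_on (chart_map c ` chart_dom c) h"
    and K: "compact K" "K \<subseteq> chart_map c ` chart_dom c"
    and zero: "\<And>x. x \<notin> K \<Longrightarrow> h x = 0"
  shows "smooth_fun A (\<lambda>q. if q \<in> chart_dom c then h (chart_map c q) else 0)"
  unfolding smooth_fun_def comp_def
proof (intro ballI smooth_on_local)
  let ?F = "\<lambda>q. if q \<in> chart_dom c then h (chart_map c q) else 0"
  fix d x assume d: "d \<in> A" and "x \<in> chart_map d ` chart_dom d"
  then obtain q where q: "q \<in> chart_dom d" "x = chart_map d q" by blast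
  show "\<exists>T. open T \<and> x \<in> T \<and> smooth_on T (\<lambda>x. ?F (chart_inv d x))"
  proof (cases "q \<in> chart_dom c")
    case True
    let ?T = "chart_map d ` (chart_dom c \<inter> chart_dom d)"
    have T: "open ?T" using c d by (intro chart_open_image) (auto simp: chart_open)
    have "smooth_on ?T (\<lambda>x. h (chart_map c (chart_inv d x)))"
      by (rule smooth_on_compose[OF T chart_open(2)[OF c] _ h transition_smooth[OF c d]])
         (use d in auto)
    then have "smooth_on ?T (\<lambda>x. ?F (chart_inv d x))"
      by (rule smooth_on_cong[OF T]) (use d in auto)
    then show ?thesis using T q True by blast
  next
    case False
    let ?T = "chart_map d ` (chart_dom d - chart_inv c ` K)"
    have "compact (chart_inv c ` K)"
      by (rule compact_continuous_image[OF continuous_on_subset K(1)])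
         (use chart_homeomorphism[OF c] K(2) in \<open>auto simp: homeomorphism_def\<close>)
    then have "open (chart_dom d - chart_inv c ` K)"
      by (intro open_Diff chart_open d compact_imp_closed)
    then have T: "open ?T" by (intro chart_open_image d) auto
    have "chart_inv c ` K \<subseteq> chart_dom c" using K(2) c by force
    then have "x \<in> ?T" using False q by blast
    moreover have "smooth_on ?T (\<lambda>x. ?F (chart_inv d x))"
    proof (rule smooth_on_cong[OF T smooth_on_const[OF T, of 0]])
      fix y assume "y \<in> ?T"
      then obtain r where r: "r \<in> chart_dom d" "r \<notin> chart_inv c ` K" "y = chart_map d r" by blast
      then have "r \<in> chart_dom c \<Longrightarrow> chart_map c r \<notin> K" using c by (metis chart_inv_map image_eqI)
      then show "0 = ?F (chart_inv d y)" using r d zero by auto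
    qed
    ultimately show ?thesis using T by blast
  qed
qed

text \<open>The last property is the purpose of a cutoff: multiplied by it, a function that is smooth in the
  chart only becomes a smooth function on the whole manifold.\<close>

lemma cutoff_exists:
  assumes c: "c \<in> A" and p: "p \<in> chart_dom c" and V: "open V" "p \<in> V"
  obtains \<phi> W where "open W" "p \<in> W" "W \<subseteq> V" "W \<subseteq> chart_dom c" "\<And>q. q \<in> W \<Longrightarrow> \<phi> q = (1::real)"
    "\<And>q. q \<notin> V \<Longrightarrow> \<phi> q = 0" "\<And>q. q \<notin> chart_dom c \<Longrightarrow> \<phi> q = 0"
    "\<And>h. smooth_on (chart_map c ` chart_dom c) h \<Longrightarrow>
        smooth_fun A (\<lambda>q. \<phi> q * h (chart_map c q))"
proof -
  let ?U = "chart_map c ` (V \<inter> chart_dom c)"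
  have "open ?U" using c V by (intro chart_open_image) (auto simp: chart_open)
  moreover have "chart_map c p \<in> ?U" using p V by blast
  ultimately obtain e where e: "e > 0" "cball (chart_map c p) e \<subseteq> ?U"
    using open_contains_cball by blast
  obtain b :: "real ^ 'n \<Rightarrow> real" where b: "smooth_on UNIV b"
      "\<And>y. y \<in> ball (chart_map c p) (e / 2) \<Longrightarrow> b y = 1"
      "\<And>y. 2 * (e / 2) \<le> dist (chart_map c p) y \<Longrightarrow> b y = 0"
    using bump_exists[of "e / 2" "chart_map c p"] e(1) by auto
  have b0: "b y = 0" if "y \<notin> cball (chart_map c p) e" for y
    using b(3)[of y] that by simp
  define \<phi> where "\<phi> = (\<lambda>q. if q \<in> chart_dom c then b (chart_map c q) else 0)"
  define W where "W = chart_inv c ` ball (chart_map c p) (e / 2)"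
  have sub: "ball (chart_map c p) (e / 2) \<subseteq> cball (chart_map c p) e"
    using e(1) by auto
  show thesis
  proof
    have W: "W \<subseteq> V \<inter> chart_dom c" using sub e(2) c by (force simp: W_def)
    then show "W \<subseteq> V" "W \<subseteq> chart_dom c" by auto
    have "openin (top_of_set (chart_map c ` chart_dom c)) (ball (chart_map c p) (e / 2))"
      using sub e(2) c by (auto simp: openin_open_eq chart_open)
    then have "openin (top_of_set (chart_dom c)) W"
      unfolding W_def
      by (rule homeomorphism_imp_open_map[OF homeomorphism_sym[THEN iffD1, OF chart_homeomorphism[OF c]]])
    then show "open W" using openin_open_eq[OF chart_open(1)[OF c]] by blast
    show "p \<in> W" using c p e(1) by (auto simp: W_def image_iff intro!: bexI[of _ "chart_map c p"])
    show "\<phi> q = 1" if q: "q \<in> W" for q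
    proof -
      obtain y where y: "y \<in> ball (chart_map c p) (e / 2)" "q = chart_inv c y"
        using q unfolding W_def by blast
      moreover obtain r where "r \<in> chart_dom c" "y = chart_map c r"
        using y(1) sub e(2) by blast
      ultimately show ?thesis using b(2) c by (simp add: \<phi>_def)
    qed
    show "\<phi> q = 0" if "q \<notin> V" for q
    proof (cases "q \<in> chart_dom c")
      case True
      have "chart_map c q \<notin> ?U"
      proof
        assume "chart_map c q \<in> ?U"
        then obtain r where "r \<in> V" "r \<in> chart_dom c" "chart_map c q = chart_map c r" by blast
        then have "r = q" using chart_inv_map[OF c] True by metis
        then show False using \<open>r \<in> V\<close> that by simp
      qed
      then have "b (chart_map c q) = 0" using e(2) by (intro b0) blast
      then show ?thesis by (simp add: \<phi>_def)
    qed (simp add: \<phi>_def)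
    show "\<phi> q = 0" if "q \<notin> chart_dom c" for q using that by (simp add: \<phi>_def)
    fix h :: "real ^ 'n \<Rightarrow> real" assume h: "smooth_on (chart_map c ` chart_dom c) h"
    have "smooth_fun A (\<lambda>q. if q \<in> chart_dom c then b (chart_map c q) * h (chart_map c q) else 0)"
    proof (rule smooth_fun_extend_by_zero[OF c, of "\<lambda>x. b x * h x"])
      show "smooth_on (chart_map c ` chart_dom c) (\<lambda>x. b x * h x)"
        by (intro smooth_on_mult chart_open c h smooth_on_mono[OF b(1)]) auto
      show "cball (chart_map c p) e \<subseteq> chart_map c ` chart_dom c" using e(2) by blast
    qed (use b0 in auto)
    also have "(\<lambda>q. if q \<in> chart_dom c then b (chart_map c q) * h (chart_map c q) else 0)
        = (\<lambda>q. \<phi> q * h (chart_map c q))"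
      by (auto simp: \<phi>_def)
    finally show "smooth_fun A (\<lambda>q. \<phi> q * h (chart_map c q))" .
  qed
qed

lemma chart_differentiable:
  "smooth_fun A f \<Longrightarrow> c \<in> A \<Longrightarrow> p \<in> chart_dom c \<Longrightarrow>
    (\<lambda>x. f (chart_inv c x)) differentiable (at (chart_map c p))"
  using smooth_on_differentiable[OF smooth_fun_in_chart] by blast

text \<open>Combinations of coordinate vectors are directional derivatives in the chart, by linearity of the
  derivative.\<close>

lemma coord_comb_derivative:
  assumes "c \<in> A" "p \<in> chart_dom c"
  shows "coord_comb A c p a = (\<lambda>f. if smooth_fun A f
    then frechet_derivative (\<lambda>x. f (chart_inv c x)) (at (chart_map c p)) a else 0)"
proof
  fix f :: "'m \<Rightarrow> real"
  let ?L = "frechet_derivative (\<lambda>x. f (chart_inv c x)) (at (chart_map c p))"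
  have "(\<Sum>i\<in>UNIV. a $ i * ?L (axis i 1)) = ?L a" if "smooth_fun A f"
  proof -
    have "linear ?L" using chart_differentiable[OF that assms] by (rule linear_frechet_derivative)
    then have "?L (\<Sum>i\<in>UNIV. a $ i *\<^sub>R axis i 1) = (\<Sum>i\<in>UNIV. a $ i * ?L (axis i 1))"
      by (simp add: linear_sum linear_scale)
    then show ?thesis using basis_expansion[of a] by (simp add: scalar_mult_eq_scaleR)
  qed
  then show "coord_comb A c p a f = (if smooth_fun A f then ?L a else 0)"
    by (simp add: coord_comb_def coord_vec_def comp_def)
qed

text \<open>Tangent vectors only see a function near their base point, so a derivative may be computed with any
  \<open>h\<close> that expresses the function on a neighbourhood.\<close>

lemma coord_comb_local:
  assumes "c \<in> A" "smooth_fun A f" "open W" "q \<in> W" "W \<subseteq> chart_dom c"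
    and h: "(h has_derivative h') (at (chart_map c q))" "\<And>r. r \<in> W \<Longrightarrow> f r = h (chart_map c r)"
  shows "coord_comb A c q a f = h' a"
proof -
  have "((\<lambda>x. f (chart_inv c x)) has_derivative h') (at (chart_map c q))"
    by (rule has_derivative_transform_within_open[OF h(1), of "chart_map c ` W"])
       (use assms in \<open>auto intro!: chart_open_image simp: subset_iff\<close>)
  then show ?thesis
    using assms(1,2,4,5) by (auto simp: coord_comb_derivative frechet_derivative_at[symmetric])
qed

text \<open>The chain rule for the transition map. It frees tangent vectors from the chart that their
  definition happens to use.\<close>

lemma coord_comb_change_chart:
  assumes "c \<in> A" "d \<in> A" "p \<in> chart_dom c" "p \<in> chart_dom d"
  shows "coord_comb A d p a =
    coord_comb A c p (frechet_derivative (\<lambda>x. chart_map c (chart_inv d x)) (at (chart_map d p)) a)"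
    (is "_ = coord_comb A c p (?J a)")
proof
  fix f :: "'m \<Rightarrow> real"
  show "coord_comb A d p a f = coord_comb A c p (?J a) f"
  proof (cases "smooth_fun A f")
    case True
    let ?L = "frechet_derivative (\<lambda>x. f (chart_inv c x)) (at (chart_map c p))"
    have "((\<lambda>x. chart_map c (chart_inv d x)) has_derivative ?J) (at (chart_map d p))"
      using assms by (intro has_frechet_derivative smooth_on_differentiable[OF transition_smooth]) auto
    moreover have "((\<lambda>x. f (chart_inv c x)) has_derivative ?L) (at (chart_map c (chart_inv d (chart_map d p))))"
      using has_frechet_derivative[OF chart_differentiable[OF True]] assms by simp
    ultimately have comp: "((\<lambda>x. f (chart_inv c (chart_map c (chart_inv d x)))) has_derivative (\<lambda>v. ?L (?J v)))
        (at (chart_map d p))"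
      by (rule has_derivative_compose)
    have "coord_comb A d p a f = ?L (?J a)"
      by (rule coord_comb_local[OF assms(2) True _ _ _ comp, of "chart_dom c \<inter> chart_dom d"])
         (use assms in \<open>auto simp: chart_open\<close>)
    then show ?thesis using True assms by (simp add: coord_comb_derivative)
  qed (use assms in \<open>simp add: coord_comb_derivative\<close>)
qed

lemma coord_comb_tangent:
  "c \<in> A \<Longrightarrow> p \<in> chart_dom c \<Longrightarrow> coord_comb A c p a \<in> tangent_space A p"
  unfolding tangent_space_def by blast

lemma tangent_in_chart:
  assumes "v \<in> tangent_space A p" "c \<in> A" "p \<in> chart_dom c"
  obtains a where "v = coord_comb A c p a"
  using assms coord_comb_change_chart unfolding tangent_space_def by blast

text \<open>The coordinates of \<open>c\<close>, multiplied by a cutoff that is 1 near \<open>p\<close>, are global smooth functions.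
  Applying a
  tangent vector to them reads off its components, and applying a vector field to them shows that
  its components are smooth.\<close>

lemma coordinate_functions:
  assumes c: "c \<in> A" and p: "p \<in> chart_dom c" and V: "open V" "p \<in> V"
  obtains x W where "open W" "p \<in> W" "W \<subseteq> V" "W \<subseteq> chart_dom c" "\<And>m. smooth_fun A (x m)"
    "\<And>q a m. q \<in> W \<Longrightarrow> coord_comb A c q a (x m) = a $ m"
proof -
  obtain \<phi> W where W: "open W" "p \<in> W" "W \<subseteq> V" "W \<subseteq> chart_dom c" "\<And>q. q \<in> W \<Longrightarrow> \<phi> q = (1::real)"
    and \<phi>: "\<And>h. smooth_on (chart_map c ` chart_dom c) h \<Longrightarrow> smooth_fun A (\<lambda>q. \<phi> q * h (chart_map c q))"
    using cutoff_exists[OF c p V] by metis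
  let ?x = "\<lambda>m q. \<phi> q * chart_map c q $ m"
  have smooth: "smooth_fun A (?x m)" for m
    by (rule \<phi>) (intro smooth_on_bounded_linear[OF _ bounded_linear_vec_nth] smooth_on_id chart_open c)
  show thesis
  proof
    show "coord_comb A c q a (?x m) = a $ m" if "q \<in> W" for q a m
    proof (rule coord_comb_local[OF c smooth W(1) that W(4)])
      show "((\<lambda>y. y $ m) has_derivative (\<lambda>v. v $ m)) (at (chart_map c q))"
        by (intro bounded_linear_imp_has_derivative bounded_linear_vec_nth)
    qed (simp add: W(5))
  qed (use W smooth in auto)
qed

text \<open>Evaluation on the extended coordinate functions recovers the coefficients, so these are
  unique.\<close>

lemma coords_coord_comb:
  assumes "c \<in> A" "p \<in> chart_dom c"
  shows "coords A c p (coord_comb A c p a) = a"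
proof -
  obtain x W where "p \<in> W" and x: "\<And>q a m. q \<in> W \<Longrightarrow> coord_comb A c q a (x m) = a $ m"
    using coordinate_functions[OF assms open_UNIV UNIV_I] by metis
  have "b = a" if "coord_comb A c p a = coord_comb A c p b" for b
    using x[OF \<open>p \<in> W\<close>] that by (metis vec_eq_iff)
  then show ?thesis unfolding coords_def by (intro the_equality) auto
qed

lemma coord_comb_coords:
  assumes "c \<in> A" "p \<in> chart_dom c" "v \<in> tangent_space A p"
  shows "coord_comb A c p (coords A c p v) = v"
  using tangent_in_chart[OF assms(3,1,2)] coords_coord_comb[OF assms(1,2)] by metis

lemma coord_comb_add:
  "coord_comb A c p (r *\<^sub>R a + s *\<^sub>R b) = (\<lambda>f. r * coord_comb A c p a f + s * coord_comb A c p b f)"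
  by (simp add: coord_comb_def sum_distrib_left sum.distrib algebra_simps)

lemma tangent_space_combination:
  assumes "u \<in> tangent_space A p" "v \<in> tangent_space A p"
  shows "(\<lambda>f. r * u f + s * v f) \<in> tangent_space A p"
proof -
  obtain c where c: "c \<in> A" "p \<in> chart_dom c" using chart_exists by blast
  obtain a b where "u = coord_comb A c p a" "v = coord_comb A c p b"
    using assms c tangent_in_chart by metis
  then show ?thesis using coord_comb_tangent[OF c] coord_comb_add[of c p r a s b] by metis
qed

lemma coords_combination:
  assumes "c \<in> A" "p \<in> chart_dom c" "u \<in> tangent_space A p" "v \<in> tangent_space A p"
  shows "coords A c p (\<lambda>f. r * u f + s * v f) = r *\<^sub>R coords A c p u + s *\<^sub>R coords A c p v"
proof -
  obtain a b where "u = coord_comb A c p a" "v = coord_comb A c p b"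
    using assms tangent_in_chart by metis
  then show ?thesis
    using coords_coord_comb[OF assms(1,2)] by (simp flip: coord_comb_add)
qed

lemma zero_tangent: "(\<lambda>f. 0) \<in> tangent_space A p"
proof -
  obtain c where "c \<in> A" "p \<in> chart_dom c" using chart_exists by blast
  then show ?thesis using coord_comb_tangent[of c p 0] by (simp add: coord_comb_def)
qed

text \<open>The value on functions that are not smooth has to be controlled because fields are compared as
  functions on all arguments.\<close>

lemma tangent_not_smooth: "v \<in> tangent_space A p \<Longrightarrow> \<not> smooth_fun A f \<Longrightarrow> v f = 0"
  unfolding tangent_space_def coord_comb_def coord_vec_def by auto

lemma tangent_const:
  assumes "v \<in> tangent_space A p"
  shows "v (\<lambda>q. r) = 0"
  using assms unfolding tangent_space_def coord_comb_def coord_vec_def comp_def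
  by (auto simp: smooth_fun_const)

section \<open>Vector fields\<close>

lemma vector_fieldD:
  assumes "vector_field A X"
  shows "X p \<in> tangent_space A p" "smooth_fun A f \<Longrightarrow> smooth_fun A (\<lambda>p. X p f)"
  using assms unfolding vector_field_def vf_apply_def by auto

lemma vector_fieldI:
  "(\<And>p. X p \<in> tangent_space A p) \<Longrightarrow> (\<And>f. smooth_fun A f \<Longrightarrow> smooth_fun A (\<lambda>p. X p f)) \<Longrightarrow>
    vector_field A X"
  unfolding vector_field_def vf_apply_def by auto

lemma vector_field_add:
  assumes "vector_field A X" "vector_field A Y"
  shows "vector_field A (vf_add X Y)"
  unfolding vf_add_def
proof (rule vector_fieldI)
  show "(\<lambda>f. X p f + Y p f) \<in> tangent_space A p" for p
    using tangent_space_combination[OF vector_fieldD(1)[OF assms(1)] vector_fieldD(1)[OF assms(2)], of 1 p 1]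
    by simp
qed (use assms in \<open>auto intro: smooth_fun_add vector_fieldD\<close>)

lemma vector_field_scale:
  assumes "smooth_fun A h" "vector_field A X"
  shows "vector_field A (vf_scale h X)"
  unfolding vf_scale_def
proof (rule vector_fieldI)
  show "(\<lambda>f. h p * X p f) \<in> tangent_space A p" for p
    using tangent_space_combination[OF vector_fieldD(1)[OF assms(2)] zero_tangent, of "h p" p 0]
    by simp
qed (use assms in \<open>auto intro: smooth_fun_mult vector_fieldD\<close>)

lemma vf_diff_eq: "vf_diff X Y = vf_add X (vf_scale (\<lambda>p. - 1) Y)"
  by (simp add: vf_diff_def vf_add_def vf_scale_def)

lemma vector_field_diff:
  "vector_field A X \<Longrightarrow> vector_field A Y \<Longrightarrow> vector_field A (vf_diff X Y)"
  unfolding vf_diff_eq by (intro vector_field_add vector_field_scale smooth_fun_const)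

lemma vector_field_zero: "vector_field A (\<lambda>p f. 0)"
  by (intro vector_fieldI zero_tangent smooth_fun_const)

lemma vector_field_sum:
  assumes "\<And>i. i \<in> I \<Longrightarrow> vector_field A (X i)"
  shows "vector_field A (\<lambda>p f. \<Sum>i\<in>I. X i p f)"
  using assms
proof (induction I rule: infinite_finite_induct)
  case (insert i I)
  then have "vector_field A (vf_add (X i) (\<lambda>p f. \<Sum>i\<in>I. X i p f))"
    by (intro vector_field_add) auto
  then show ?case using insert by (simp add: vf_add_def)
qed (simp_all add: vector_field_zero)

lemma coord_vec_eq_comb: "coord_vec A c i p = coord_comb A c p (axis i 1)"
  by (simp add: coord_comb_def axis_def if_distrib[of "\<lambda>x. x * _"] cong: if_cong)

text \<open>A coordinate field multiplied by a cutoff is defined and smooth everywhere; where the cutoff is 1 it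
  is the coordinate field itself.\<close>

lemma vector_field_cutoff:
  assumes c: "c \<in> A" and zero: "\<And>q. q \<notin> chart_dom c \<Longrightarrow> \<phi> q = 0"
    and \<phi>: "\<And>h. smooth_on (chart_map c ` chart_dom c) h \<Longrightarrow> smooth_fun A (\<lambda>q. \<phi> q * h (chart_map c q))"
  shows "vector_field A (vf_scale \<phi> (coord_vec A c i))"
proof (rule vector_fieldI)
  show "vf_scale \<phi> (coord_vec A c i) q \<in> tangent_space A q" for q
  proof (cases "q \<in> chart_dom c")
    case True
    show ?thesis
      using tangent_space_combination[OF coord_comb_tangent[OF c True] zero_tangent, of "\<phi> q" "axis i 1" 0]
      by (simp add: vf_scale_def coord_vec_eq_comb)
  next
    case False
    then show ?thesis using zero zero_tangent by (simp add: vf_scale_def)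
  qed
  fix f assume f: "smooth_fun A f"
  have "smooth_fun A (\<lambda>q. \<phi> q * frechet_derivative (\<lambda>x. f (chart_inv c x)) (at (chart_map c q)) (axis i 1))"
    by (rule \<phi>) (rule smooth_on_frechet_derivative[OF smooth_fun_in_chart[OF f c]])
  then show "smooth_fun A (\<lambda>q. vf_scale \<phi> (coord_vec A c i) q f)"
    using f by (simp add: vf_scale_def coord_vec_def comp_def)
qed

lemma coord_frame:
  assumes c: "c \<in> A" and p: "p \<in> chart_dom c"
  shows "vector_field A (coord_frame A c p i)"
    and "\<exists>V. open V \<and> p \<in> V \<and> V \<subseteq> chart_dom c \<and> (\<forall>q\<in>V. coord_frame A c p i q = coord_vec A c i q)"
proof -
  let ?P = "\<lambda>E. \<forall>i. vector_field A (E i) \<and>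
    (\<exists>V. open V \<and> p \<in> V \<and> V \<subseteq> chart_dom c \<and> (\<forall>q\<in>V. E i q = coord_vec A c i q))"
  obtain \<phi> W where W: "open W" "p \<in> W" "W \<subseteq> chart_dom c" "\<And>q. q \<in> W \<Longrightarrow> \<phi> q = (1::real)"
    and \<phi>: "\<And>q. q \<notin> chart_dom c \<Longrightarrow> \<phi> q = 0"
      "\<And>h. smooth_on (chart_map c ` chart_dom c) h \<Longrightarrow> smooth_fun A (\<lambda>q. \<phi> q * h (chart_map c q))"
    by (rule cutoff_exists[OF c p open_UNIV UNIV_I]) blast
  have "\<forall>q\<in>W. vf_scale \<phi> (coord_vec A c i) q = coord_vec A c i q" for i
    using W(4) by (simp add: vf_scale_def)
  then have "?P (\<lambda>i. vf_scale \<phi> (coord_vec A c i))"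
    using vector_field_cutoff[OF c \<phi>] W by blast
  then have "?P (coord_frame A c p)"
    unfolding coord_frame_def by (rule someI[of ?P])
  then show "vector_field A (coord_frame A c p i)"
    "\<exists>V. open V \<and> p \<in> V \<and> V \<subseteq> chart_dom c \<and> (\<forall>q\<in>V. coord_frame A c p i q = coord_vec A c i q)"
    by blast+
qed

text \<open>Near \<open>q\<close> the function \<open>Y f\<close> is the sum of \<open>(Y x\<^sup>m) (\<partial>\<^sub>m f)\<close>, whose coefficients are smooth. By the
  product rule, \<open>X\<close> applied to it is a second derivative of \<open>f\<close> in the directions of \<open>X\<close> and \<open>Y\<close> plus
  a tangent vector applied to \<open>f\<close>. Symmetry of second derivatives allows the direction of \<open>X\<close> to be
  taken first, so that the sum over the components of \<open>Y\<close> can be collected by linearity.\<close>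

lemma second_derivative_along_fields:
  assumes c: "c \<in> A" and W: "open W" "q \<in> W" "W \<subseteq> chart_dom c"
    and x: "\<And>m. smooth_fun A (x m)" "\<And>r a m. r \<in> W \<Longrightarrow> coord_comb A c r a (x m) = a $ m"
    and Y: "vector_field A Y" and f: "smooth_fun A f"
  defines "F \<equiv> \<lambda>y. f (chart_inv c y)"
  assumes X: "X q = coord_comb A c q a" and Yq: "Y q = coord_comb A c q b"
  shows "X q (vf_apply Y f) =
    frechet_derivative (\<lambda>y. frechet_derivative F (at y) a) (at (chart_map c q)) b +
    (\<Sum>m\<in>UNIV. X q (vf_apply Y (x m)) * coord_vec A c m q f)"
proof -
  let ?z = "chart_map c q"
  let ?e = "\<lambda>m. axis m 1 :: real ^ 'n"
  let ?D = "\<lambda>v y. frechet_derivative F (at y) v"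
  let ?Yx = "\<lambda>m y. Y (chart_inv c y) (x m)"
  have q: "q \<in> chart_dom c" using W by blast
  have F: "smooth_on (chart_map c ` chart_dom c) F"
    unfolding F_def using f c by (rule smooth_fun_in_chart)
  have D: "(?D v has_derivative frechet_derivative (?D v) (at ?z)) (at ?z)" for v
    using smooth_on_differentiable[OF smooth_on_frechet_derivative[OF F]] q
    by (intro has_frechet_derivative) auto
  have Yx: "smooth_fun A (vf_apply Y (x m))" for m
    unfolding vf_apply_def by (rule vector_fieldD(2)[OF Y x(1)])
  have X_Yx: "X q (vf_apply Y (x m)) = frechet_derivative (?Yx m) (at ?z) a" for m
    using Yx X c q by (simp add: coord_comb_derivative vf_apply_def)
  have Y_D: "(?Yx m has_derivative frechet_derivative (?Yx m) (at ?z)) (at ?z)" for m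
    using chart_differentiable[OF Yx c q] by (simp add: has_frechet_derivative vf_apply_def)
  have deriv: "((\<lambda>y. \<Sum>m\<in>UNIV. ?Yx m y * ?D (?e m) y) has_derivative
      (\<lambda>v. \<Sum>m\<in>UNIV. ?Yx m ?z * frechet_derivative (?D (?e m)) (at ?z) v +
        frechet_derivative (?Yx m) (at ?z) v * ?D (?e m) ?z)) (at ?z)"
    by (intro has_derivative_sum has_derivative_mult Y_D D)
  have expand: "vf_apply Y f r = (\<Sum>m\<in>UNIV. ?Yx m (chart_map c r) * ?D (?e m) (chart_map c r))"
    if "r \<in> W" for r
  proof -
    have r: "r \<in> chart_dom c" using that W by blast
    obtain b where "Y r = coord_comb A c r b"
      using tangent_in_chart[OF vector_fieldD(1)[OF Y] c r] by blast
    then show ?thesis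
      using x(2)[OF that] c r f
      by (simp add: vf_apply_def F_def) (simp add: coord_comb_def coord_vec_def comp_def)
  qed
  have "smooth_fun A (vf_apply Y f)"
    unfolding vf_apply_def by (rule vector_fieldD(2)[OF Y f])
  then have "X q (vf_apply Y f) =
      (\<Sum>m\<in>UNIV. ?Yx m ?z * frechet_derivative (?D (?e m)) (at ?z) a +
        frechet_derivative (?Yx m) (at ?z) a * ?D (?e m) ?z)"
    unfolding X by (rule coord_comb_local[OF c _ W deriv expand])
  also have "\<dots> = (\<Sum>m\<in>UNIV. b $ m * frechet_derivative (?D (?e m)) (at ?z) a) +
      (\<Sum>m\<in>UNIV. X q (vf_apply Y (x m)) * coord_vec A c m q f)"
    using c q f x(2)[OF W(2)] Yq
    by (simp add: sum.distrib X_Yx) (simp add: coord_vec_def comp_def F_def)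
  also have "(\<Sum>m\<in>UNIV. b $ m * frechet_derivative (?D (?e m)) (at ?z) a) =
      (\<Sum>m\<in>UNIV. b $ m * frechet_derivative (?D a) (at ?z) (?e m))"
    using second_derivative_symmetric[OF chart_open(2)[OF c] F] q by simp
  also have "\<dots> = frechet_derivative (?D a) (at ?z) (\<Sum>m\<in>UNIV. b $ m *\<^sub>R ?e m)"
    using has_derivative_linear[OF D] by (simp add: linear_sum linear_scale)
  also have "(\<Sum>m\<in>UNIV. b $ m *\<^sub>R ?e m) = b"
    using basis_expansion[of b] by (simp add: scalar_mult_eq_scaleR)
  finally show ?thesis .
qed

text \<open>The second derivatives of \<open>f\<close> in \<open>X (Y f)\<close> and \<open>Y (X f)\<close> cancel by symmetry; the rest is a
  combination of coordinate vectors.\<close>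

lemma vector_field_lie_bracket:
  assumes X: "vector_field A X" and Y: "vector_field A Y"
  shows "vector_field A (lie_bracket X Y)"
proof (rule vector_fieldI)
  fix q
  obtain c where c: "c \<in> A" "q \<in> chart_dom c" using chart_exists by blast
  obtain x W where W: "open W" "q \<in> W" "W \<subseteq> chart_dom c"
    and x: "\<And>m. smooth_fun A (x m)" "\<And>r a m. r \<in> W \<Longrightarrow> coord_comb A c r a (x m) = a $ m"
    by (rule coordinate_functions[OF c open_UNIV UNIV_I]) blast
  obtain a b where ab: "X q = coord_comb A c q a" "Y q = coord_comb A c q b"
    using tangent_in_chart[OF vector_fieldD(1) c] X Y by metis
  have "lie_bracket X Y q f =
      coord_comb A c q (\<chi> m. X q (vf_apply Y (x m)) - Y q (vf_apply X (x m))) f" for f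
  proof (cases "smooth_fun A f")
    case True
    then show ?thesis
      using second_derivative_along_fields[where X = X and q = q and x = x and Y = Y,
          OF c(1) W x Y True ab]
        second_derivative_along_fields[where X = Y and q = q and x = x and Y = X,
          OF c(1) W x X True ab(2,1)]
        second_derivative_symmetric[OF chart_open(2)[OF c(1)] smooth_fun_in_chart[OF True c(1)], of "chart_map c q" a b]
        c(2)
      by (simp add: lie_bracket_def coord_comb_def left_diff_distrib sum_subtractf)
  next
    case False
    then have vanish: "vf_apply Z f = (\<lambda>r. 0)" if "vector_field A Z" for Z
      using tangent_not_smooth[OF vector_fieldD(1)[OF that]] by (simp add: vf_apply_def)
    have const: "Z q (\<lambda>r. 0) = 0" if "vector_field A Z" for Z
      by (rule tangent_const[OF vector_fieldD(1)[OF that]])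
    show ?thesis
      using False c
      by (simp add: lie_bracket_def coord_comb_derivative vanish[OF X] vanish[OF Y] const[OF X] const[OF Y])
  qed
  then have "lie_bracket X Y q =
      coord_comb A c q (\<chi> m. X q (vf_apply Y (x m)) - Y q (vf_apply X (x m)))"
    by (rule ext)
  then show "lie_bracket X Y q \<in> tangent_space A q"
    using coord_comb_tangent[OF c] by simp
next
  fix f assume f: "smooth_fun A f"
  show "smooth_fun A (\<lambda>q. lie_bracket X Y q f)"
    unfolding lie_bracket_def vf_apply_def
    by (rule smooth_fun_diff) (rule vector_fieldD(2)[OF X vector_fieldD(2)[OF Y f]]
        vector_fieldD(2)[OF Y vector_fieldD(2)[OF X f]])+
qed

section \<open>Connections and their difference tensor\<close>

lemma connection_add:
  "affine_connection A D \<Longrightarrow> vector_field A X \<Longrightarrow> vector_field A Y \<Longrightarrow> vector_field A Y' \<Longrightarrow>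
    D X (vf_add Y Y') = vf_add (D X Y) (D X Y')"
  unfolding affine_connection_def by blast

lemma connection_scale:
  "affine_connection A D \<Longrightarrow> smooth_fun A h \<Longrightarrow> vector_field A X \<Longrightarrow> vector_field A Y \<Longrightarrow>
    D X (vf_scale h Y) = vf_add (vf_scale (vf_apply X h) Y) (vf_scale h (D X Y))"
  unfolding affine_connection_def by blast

lemma connection_vector_field:
  "affine_connection A D \<Longrightarrow> vector_field A X \<Longrightarrow> vector_field A Y \<Longrightarrow> vector_field A (D X Y)"
  unfolding affine_connection_def by blast

text \<open>Constants pass through a connection because tangent vectors annihilate them.\<close>

lemma connection_combination:
  assumes "affine_connection A D" "vector_field A X" "vector_field A Y" "vector_field A Z"
  shows "D X (vf_add (vf_scale (\<lambda>p. r) Y) (vf_scale (\<lambda>p. s) Z)) =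
    vf_add (vf_scale (\<lambda>p. r) (D X Y)) (vf_scale (\<lambda>p. s) (D X Z))"
proof -
  have "X p (\<lambda>q. t) = 0" for p t
    using tangent_const[OF vector_fieldD(1)[OF assms(2)]] .
  then have "D X (vf_scale (\<lambda>p. t) U) = vf_scale (\<lambda>p. t) (D X U)" if "vector_field A U" for t U
    using connection_scale[OF assms(1) smooth_fun_const assms(2) that]
    by (simp add: vf_apply_def vf_add_def vf_scale_def)
  then show ?thesis
    using assms vector_field_scale[OF smooth_fun_const]
    by (simp add: connection_add)
qed

lemma vector_field_difference:
  assumes "affine_connection A D" "affine_connection A D'" "vector_field A X" "vector_field A Y"
  shows "vector_field A (difference_tensor D D' X Y)"
  using assms connection_vector_field[OF assms(1,3,4)] connection_vector_field[OF assms(2,3,4)]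
  by (simp add: difference_tensor_def vector_field_diff)

lemma vector_field_curvature:
  assumes D: "affine_connection A D"
    and X: "vector_field A X" and Y: "vector_field A Y" and Z: "vector_field A Z"
  shows "vector_field A (curvature D X Y Z)"
  unfolding curvature_def
  using connection_vector_field[OF D X connection_vector_field[OF D Y Z]]
    connection_vector_field[OF D Y connection_vector_field[OF D X Z]]
    connection_vector_field[OF D vector_field_lie_bracket[OF X Y] Z]
  by (simp add: vector_field_diff)

lemma difference_add:
  assumes "affine_connection A D" "affine_connection A D'"
    and "vector_field A X" "vector_field A Y" "vector_field A Z"
  shows "difference_tensor D D' X (vf_add Y Z) =
    vf_add (difference_tensor D D' X Y) (difference_tensor D D' X Z)"
  unfolding difference_tensor_def connection_add[OF assms(1,3-5)] connection_add[OF assms(2-5)]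
  by (simp add: vf_diff_def vf_add_def fun_eq_iff)

text \<open>Both connections produce the same Leibniz term \<open>X(h) Y\<close>, which cancels in the difference.\<close>

lemma difference_scale:
  assumes "affine_connection A D" "affine_connection A D'"
    and "smooth_fun A h" "vector_field A X" "vector_field A Y"
  shows "difference_tensor D D' X (vf_scale h Y) = vf_scale h (difference_tensor D D' X Y)"
  unfolding difference_tensor_def connection_scale[OF assms(1,3-5)] connection_scale[OF assms(2-5)]
  by (simp add: vf_diff_def vf_add_def vf_scale_def fun_eq_iff algebra_simps)

lemma function_linear_sum:
  assumes add: "\<And>Y Z. vector_field A Y \<Longrightarrow> vector_field A Z \<Longrightarrow> L (vf_add Y Z) = vf_add (L Y) (L Z)"
    and scale: "\<And>h Y. smooth_fun A h \<Longrightarrow> vector_field A Y \<Longrightarrow> L (vf_scale h Y) = vf_scale h (L Y)"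
    and Z: "\<And>i. i \<in> I \<Longrightarrow> vector_field A (Z i)"
  shows "L (\<lambda>p f. \<Sum>i\<in>I. Z i p f) = (\<lambda>p f. \<Sum>i\<in>I. L (Z i) p f)"
proof -
  have zero: "L (\<lambda>p f. 0) = (\<lambda>p f. 0)"
    using scale[OF smooth_fun_const[of 0] vector_field_zero] by (simp add: vf_scale_def)
  show ?thesis
    using Z
  proof (induction I rule: infinite_finite_induct)
    case (insert i I)
    have "L (vf_add (Z i) (\<lambda>p f. \<Sum>i\<in>I. Z i p f)) = vf_add (L (Z i)) (\<lambda>p f. \<Sum>i\<in>I. L (Z i) p f)"
      using insert add vector_field_sum[of I Z] by simp
    then show ?case using insert by (simp add: vf_add_def)
  qed (simp_all add: zero)
qed

text \<open>An operator on vector fields that is linear over smooth functions acts pointwise: its value at \<open>p\<close>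
  is determined by the components of the argument at \<open>p\<close>. The cutoff is supported where the frame
  consists of coordinate vectors and the extended coordinates yield components. There the argument,
  times the cutoff, expands in the frame with the global smooth coefficients \<open>\<phi> (Y x\<^sup>m)\<close>; elsewhere
  both sides vanish. Linearity then applies globally, and at \<open>p\<close> the cutoff is 1.\<close>

lemma function_linear_pointwise:
  assumes add: "\<And>Y Z. vector_field A Y \<Longrightarrow> vector_field A Z \<Longrightarrow> L (vf_add Y Z) = vf_add (L Y) (L Z)"
    and scale: "\<And>h Y. smooth_fun A h \<Longrightarrow> vector_field A Y \<Longrightarrow> L (vf_scale h Y) = vf_scale h (L Y)"
    and c: "c \<in> A" and p: "p \<in> chart_dom c" and Y: "vector_field A Y"
  shows "L Y p f = (\<Sum>m\<in>UNIV. coords A c p (Y p) $ m * L (coord_frame A c p m) p f)"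
proof -
  let ?E = "coord_frame A c p"
  have E: "vector_field A (?E m)" for m by (rule coord_frame(1)[OF c p])
  obtain V where V: "\<And>m. open (V m) \<and> p \<in> V m \<and> V m \<subseteq> chart_dom c \<and> (\<forall>q\<in>V m. ?E m q = coord_vec A c m q)"
    using coord_frame(2)[OF c p] by metis
  have "open (\<Inter>m. V m)" "p \<in> (\<Inter>m. V m)" using V by auto
  then obtain x W where W: "open W" "p \<in> W" "W \<subseteq> (\<Inter>m. V m)" "W \<subseteq> chart_dom c"
    and x: "\<And>m. smooth_fun A (x m)" "\<And>q a m. q \<in> W \<Longrightarrow> coord_comb A c q a (x m) = a $ m"
    by (rule coordinate_functions[OF c p]) blast
  obtain \<phi> U where "p \<in> U" "\<And>q. q \<in> U \<Longrightarrow> \<phi> q = (1::real)"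
    and \<phi>_out: "\<And>q. q \<notin> W \<Longrightarrow> \<phi> q = 0"
    and \<phi>_mult: "\<And>h. smooth_on (chart_map c ` chart_dom c) h \<Longrightarrow> smooth_fun A (\<lambda>q. \<phi> q * h (chart_map c q))"
    by (rule cutoff_exists[OF c p W(1,2)]) blast
  then have "\<phi> p = 1" by blast
  have \<phi>: "smooth_fun A \<phi>"
    using \<phi>_mult[OF smooth_on_const[OF chart_open(2)[OF c], of 1]] by simp
  have Yx: "smooth_fun A (\<lambda>q. \<phi> q * Y q (x m))" for m
    by (intro smooth_fun_mult \<phi> vector_fieldD(2)[OF Y] x)
  have expand: "vf_scale \<phi> Y = (\<lambda>q f. \<Sum>m\<in>UNIV. vf_scale (\<lambda>q. \<phi> q * Y q (x m)) (?E m) q f)"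
  proof (intro ext)
    fix q f
    show "vf_scale \<phi> Y q f = (\<Sum>m\<in>UNIV. vf_scale (\<lambda>q. \<phi> q * Y q (x m)) (?E m) q f)"
    proof (cases "q \<in> W")
      case True
      then have "q \<in> chart_dom c" using W by blast
      then obtain a where a: "Y q = coord_comb A c q a"
        using tangent_in_chart[OF vector_fieldD(1)[OF Y] c] by blast
      have "?E m q = coord_vec A c m q" for m using V True W(3) by blast
      then have "(\<Sum>m\<in>UNIV. vf_scale (\<lambda>q. \<phi> q * Y q (x m)) (?E m) q f) =
          \<phi> q * (\<Sum>m\<in>UNIV. a $ m * coord_vec A c m q f)"
        by (simp add: vf_scale_def a x(2)[OF True] sum_distrib_left mult.assoc)
      then show ?thesis by (simp add: vf_scale_def a coord_comb_def)
    qed (simp add: vf_scale_def \<phi>_out)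
  qed
  have "vf_scale \<phi> (L Y) = L (vf_scale \<phi> Y)"
    using scale[OF \<phi> Y] by simp
  also have "\<dots> = (\<lambda>q f. \<Sum>m\<in>UNIV. L (vf_scale (\<lambda>q. \<phi> q * Y q (x m)) (?E m)) q f)"
    unfolding expand
    by (rule function_linear_sum[of L, OF add scale vector_field_scale[OF Yx E]])
  also have "\<dots> = (\<lambda>q f. \<Sum>m\<in>UNIV. (\<phi> q * Y q (x m)) * L (?E m) q f)"
    using scale[OF Yx E] by (simp add: vf_scale_def)
  finally have "vf_scale \<phi> (L Y) p f = (\<Sum>m\<in>UNIV. (\<phi> p * Y p (x m)) * L (?E m) p f)"
    by simp
  moreover have "Y p (x m) = coords A c p (Y p) $ m" for m
    using x(2)[OF W(2)] coord_comb_coords[OF c p vector_fieldD(1)[OF Y]] by metis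
  ultimately show ?thesis using \<open>\<phi> p = 1\<close> by (simp add: vf_scale_def)
qed

lemma coords_sum:
  assumes c: "c \<in> A" and p: "p \<in> chart_dom c" and v: "\<And>i. i \<in> I \<Longrightarrow> v i \<in> tangent_space A p"
  shows "coords A c p (\<lambda>f. \<Sum>i\<in>I. r i * v i f) = (\<Sum>i\<in>I. r i *\<^sub>R coords A c p (v i))"
proof -
  have "(\<lambda>f. \<Sum>i\<in>I. r i * v i f) = coord_comb A c p (\<Sum>i\<in>I. r i *\<^sub>R coords A c p (v i))"
    using v
  proof (induction I rule: infinite_finite_induct)
    case (insert i I)
    have "v i = coord_comb A c p (coords A c p (v i))"
      using coord_comb_coords[OF c p] insert by simp
    then show ?case
      using insert coord_comb_add[of c p "r i" "coords A c p (v i)" 1] by (simp add: fun_eq_iff)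
  qed (simp_all add: coord_comb_def)
  then show ?thesis by (simp add: coords_coord_comb[OF c p])
qed

lemma coords_difference:
  assumes conn: "affine_connection A D" "affine_connection A D'"
    and c: "c \<in> A" and p: "p \<in> chart_dom c" and X: "vector_field A X" and Y: "vector_field A Y"
  shows "coords A c p (difference_tensor D D' X Y p) =
    (\<Sum>m\<in>UNIV. coords A c p (Y p) $ m *\<^sub>R
      coords A c p (difference_tensor D D' X (coord_frame A c p m) p))"
proof -
  have "difference_tensor D D' X Y p = (\<lambda>f. \<Sum>m\<in>UNIV. coords A c p (Y p) $ m *
      difference_tensor D D' X (coord_frame A c p m) p f)"
    by (intro ext function_linear_pointwise[of "difference_tensor D D' X", OF _ _ c p Y]
        difference_add difference_scale conn X)
  then show ?thesis
    by (simp only:) (rule coords_sum[OF c p vector_fieldD(1)[OF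
          vector_field_difference[OF conn X coord_frame(1)[OF c p]]]])
qed

section \<open>Curvature of the alpha connection\<close>

text \<open>The mixed terms \<open>D X (D' Y Z)\<close> and \<open>D' X (D Y Z)\<close> have equal coefficients, and their sum is the
  sum of the pure terms minus the difference tensor applied twice.\<close>

lemma alpha_second_derivative:
  assumes conn: "affine_connection A D" "affine_connection A D'"
    and X: "vector_field A X" and Y: "vector_field A Y" and Z: "vector_field A Z"
  shows "alpha_connection \<alpha> D D' X (alpha_connection \<alpha> D D' Y Z) p f =
    (1 + \<alpha>) / 2 * D X (D Y Z) p f + (1 - \<alpha>) / 2 * D' X (D' Y Z) p f
    - (1 - \<alpha>\<^sup>2) / 4 * difference_tensor D D' X (difference_tensor D D' Y Z) p f"
proof -
  have YZ: "vector_field A (D Y Z)" "vector_field A (D' Y Z)"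
    using connection_vector_field[OF conn(1) Y Z] connection_vector_field[OF conn(2) Y Z] .
  have expand: "B X (alpha_connection \<alpha> D D' Y Z) p f =
      (1 + \<alpha>) / 2 * B X (D Y Z) p f + (1 - \<alpha>) / 2 * B X (D' Y Z) p f"
    if "affine_connection A B" for B
    unfolding alpha_connection_def connection_combination[OF that X YZ]
    by (simp add: vf_add_def vf_scale_def)
  have diff: "B X (difference_tensor D D' Y Z) p f = B X (D' Y Z) p f - B X (D Y Z) p f"
    if "affine_connection A B" for B
    using connection_combination[OF that X YZ, of "- 1" 1]
    by (simp add: difference_tensor_def vf_diff_def vf_add_def vf_scale_def)
  have outer: "alpha_connection \<alpha> D D' X (alpha_connection \<alpha> D D' Y Z) p f =
      (1 + \<alpha>) / 2 * D X (alpha_connection \<alpha> D D' Y Z) p f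
      + (1 - \<alpha>) / 2 * D' X (alpha_connection \<alpha> D D' Y Z) p f"
    by (simp add: alpha_connection_def[of \<alpha> D D' X] vf_add_def vf_scale_def)
  have tensor: "difference_tensor D D' X (difference_tensor D D' Y Z) p f =
      D' X (difference_tensor D D' Y Z) p f - D X (difference_tensor D D' Y Z) p f"
    by (simp add: difference_tensor_def[of D D' X] vf_diff_def)
  show ?thesis
    unfolding outer tensor expand[OF conn(1)] expand[OF conn(2)] diff[OF conn(1)] diff[OF conn(2)]
    by (simp add: field_simps power2_eq_square)
qed

text \<open>The bracket terms match without correction, since the alpha connection is by definition the same
  combination of the two connections as on the right-hand side.\<close>

lemma curvature_alpha:
  assumes conn: "affine_connection A D" "affine_connection A D'"
    and X: "vector_field A X" and Y: "vector_field A Y" and Z: "vector_field A Z"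
  shows "curvature (alpha_connection \<alpha> D D') X Y Z p f =
    (1 + \<alpha>) / 2 * curvature D X Y Z p f + (1 - \<alpha>) / 2 * curvature D' X Y Z p f
    + (1 - \<alpha>\<^sup>2) / 4 * (difference_tensor D D' Y (difference_tensor D D' X Z) p f
        - difference_tensor D D' X (difference_tensor D D' Y Z) p f)"
proof -
  have "alpha_connection \<alpha> D D' (lie_bracket X Y) Z p f =
      (1 + \<alpha>) / 2 * D (lie_bracket X Y) Z p f + (1 - \<alpha>) / 2 * D' (lie_bracket X Y) Z p f"
    by (simp add: alpha_connection_def vf_add_def vf_scale_def)
  then show ?thesis
    unfolding curvature_def vf_diff_def alpha_second_derivative[OF conn X Y Z]
      alpha_second_derivative[OF conn Y X Z]
    by (simp only: algebra_simps)
qed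

text \<open>By pointwise linearity, each double application of the difference tensor becomes a product of
  components at \<open>p\<close>.\<close>

lemma curvature_comp_alpha:
  assumes conn: "affine_connection A D" "affine_connection A D'"
    and c: "c \<in> A" and p: "p \<in> chart_dom c"
  defines "K \<equiv> difference_comp A c D D' p"
  shows "curvature_comp A c (alpha_connection \<alpha> D D') p j i k l =
    (1 + \<alpha>) / 2 * curvature_comp A c D p j i k l + (1 - \<alpha>) / 2 * curvature_comp A c D' p j i k l
    + (1 - \<alpha>\<^sup>2) / 4 * (\<Sum>m\<in>UNIV. K m k i * K j l m - K m l i * K j k m)"
proof -
  let ?E = "coord_frame A c p"
  let ?T = "difference_tensor D D'"
  have E: "vector_field A (?E m)" for m by (rule coord_frame(1)[OF c p])
  have T: "vector_field A (?T X Y)" if "vector_field A X" "vector_field A Y" for X Y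
    using vector_field_difference[OF conn that] .
  have R: "curvature D (?E k) (?E l) (?E i) p \<in> tangent_space A p"
      "curvature D' (?E k) (?E l) (?E i) p \<in> tangent_space A p"
    using vector_fieldD(1)[OF vector_field_curvature[OF conn(1) E E E]]
      vector_fieldD(1)[OF vector_field_curvature[OF conn(2) E E E]] by simp_all
  have KK: "coords A c p (?T (?E l) (?T (?E k) (?E i)) p) $ j = (\<Sum>m\<in>UNIV. K m k i * K j l m)" for k l
    using coords_difference[OF conn c p E T[OF E E]] by (simp add: K_def difference_comp_def Let_def)
  let ?Q = "\<lambda>f. 1 * ?T (?E l) (?T (?E k) (?E i)) p f + (- 1) * ?T (?E k) (?T (?E l) (?E i)) p f"
  let ?R = "\<lambda>f. (1 + \<alpha>) / 2 * curvature D (?E k) (?E l) (?E i) p f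
      + (1 - \<alpha>) / 2 * curvature D' (?E k) (?E l) (?E i) p f"
  have T': "?T (?E l) (?T (?E k) (?E i)) p \<in> tangent_space A p" for k l
    by (rule vector_fieldD(1)[OF T[OF E T[OF E E]]])
  have "curvature (alpha_connection \<alpha> D D') (?E k) (?E l) (?E i) p =
      (\<lambda>f. 1 * ?R f + (1 - \<alpha>\<^sup>2) / 4 * ?Q f)"
    using curvature_alpha[OF conn E E E] by (simp add: fun_eq_iff)
  then have "coords A c p (curvature (alpha_connection \<alpha> D D') (?E k) (?E l) (?E i) p) =
      1 *\<^sub>R coords A c p ?R + ((1 - \<alpha>\<^sup>2) / 4) *\<^sub>R coords A c p ?Q"
    by (simp only:) (rule coords_combination[OF c p tangent_space_combination[OF R]
        tangent_space_combination[OF T' T']])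
  then show ?thesis
    unfolding coords_combination[OF c p R] coords_combination[OF c p T' T']
    by (simp add: curvature_comp_def Let_def KK sum_subtractf)
qed

text \<open>The trace over the first and third lower curvature index turns the two products of
  \<open>curvature_comp_alpha\<close> into the two terms of \<open>cal_K\<close>, in the same order.\<close>

lemma ricci_alpha:
  assumes conn: "affine_connection A D" "affine_connection A D'"
    and c: "c \<in> A" and p: "p \<in> chart_dom c"
  shows "ricci A c (alpha_connection \<alpha> D D') p l j =
    (1 + \<alpha>) / 2 * ricci A c D p l j + (1 - \<alpha>) / 2 * ricci A c D' p l j
    + (1 - \<alpha>\<^sup>2) / 4 * cal_K A c D D' p l j"
  by (simp add: ricci_def cal_K_def Let_def curvature_comp_alpha[OF conn c p] sum.distrib
      sum_distrib_left mult.commute[of "difference_comp A c D D' p _ j l"])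

end

lemma metric_trace_combination:
  "metric_trace A c g p (\<lambda>l j. r * S l j + s * T l j + t * U l j) =
    r * metric_trace A c g p S + s * metric_trace A c g p T + t * metric_trace A c g p U"
  by (simp add: metric_trace_def sum_distrib_left sum.distrib algebra_simps)

theorem theorem6p7:
  fixes A :: "('m::{t2_space, second_countable_topology}, 'n::finite) chart set"
    and g :: "'m bilin_field" and D D' :: "'m vf_op" and \<alpha> :: real
  assumes "smooth_manifold A"
    and "pseudo_riemannian_metric A g"
    and "dual_connections A g D D'"
  shows "\<forall>c\<in>A. \<forall>p\<in>chart_dom c.
    (\<forall>l j. ricci A c (alpha_connection \<alpha> D D') p l j =
       (1 + \<alpha>) / 2 * ricci A c D p l j + (1 - \<alpha>) / 2 * ricci A c D' p l j
       + (1 - \<alpha>\<^sup>2) / 4 * cal_K A c D D' p l j) \<and>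
    ricci_scalar A c g (alpha_connection \<alpha> D D') p =
       (1 + \<alpha>) / 2 * ricci_scalar A c g D p + (1 - \<alpha>) / 2 * ricci_scalar A c g D' p
       + (1 - \<alpha>\<^sup>2) / 4 * cal_K_scalar A c g D D' p"
proof (intro ballI conjI allI)
  fix c p assume c: "c \<in> A" "p \<in> chart_dom c"
  have conn: "affine_connection A D" "affine_connection A D'"
    using assms(3) by (simp_all add: dual_connections_def)
  show ricci: "ricci A c (alpha_connection \<alpha> D D') p l j =
       (1 + \<alpha>) / 2 * ricci A c D p l j + (1 - \<alpha>) / 2 * ricci A c D' p l j
       + (1 - \<alpha>\<^sup>2) / 4 * cal_K A c D D' p l j" for l j
    by (rule ricci_alpha[OF assms(1) conn c])
  have "ricci A c (alpha_connection \<alpha> D D') p = (\<lambda>l j.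
       (1 + \<alpha>) / 2 * ricci A c D p l j + (1 - \<alpha>) / 2 * ricci A c D' p l j
       + (1 - \<alpha>\<^sup>2) / 4 * cal_K A c D D' p l j)"
    by (intro ext ricci)
  then show "ricci_scalar A c g (alpha_connection \<alpha> D D') p =
       (1 + \<alpha>) / 2 * ricci_scalar A c g D p + (1 - \<alpha>) / 2 * ricci_scalar A c g D' p
       + (1 - \<alpha>\<^sup>2) / 4 * cal_K_scalar A c g D D' p"
    unfolding ricci_scalar_def cal_K_scalar_def by (simp only: metric_trace_combination)
qed

end
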